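(* Let $\mathfrak g$ be a braided Lie algebra associated with a triangular Hopf algebra $(K,\mathsf R)$ and let $\mathsf F$ be a twist for $K$. The $K_{\mathsf F}$-module $\mathfrak g_{\mathsf F}$ with bilinear map $$[\ ,\ ]_{\mathsf F}:\mathfrak g_{\mathsf F}\otimes\mathfrak g_{\mathsf F}\to\mathfrak g_{\mathsf F},\qquad u\otimes v\mapsto[u,v]_{\mathsf F}:=[\bar{\mathsf F}^\alpha\triangleright u,\bar{\mathsf F}_\alpha\triangleright v]$$ is a braided Lie algebra associated with $(K_{\mathsf F},\mathsf R_{\mathsf F})$.
   Context: $\Bbbk$ is a field, or the ring of formal power series in a variable over a field; $\otimes$ over $\Bbbk$; sums understood. Triangular Hopf algebra $(K,\mathsf R)$: $\mathsf R=\mathsf R^\alpha\otimes\mathsf R_\alpha\in K\otimes K$ invertible, $\Delta^{cop}(k)=\mathsf R\Delta(k)\mathsf R^{-1}$, $(\Delta\otimes\mathrm{id})\mathsf R=\mathsf R_{13}\mathsf R_{23}$, $(\mathrm{id}\otimes\Delta)\mathsf R=\mathsf R_{13}\mathsf R_{12}$, $\mathsf R^{-1}=\mathsf R_{21}$. A braided Lie algebra associated with $(K,\mathsf R)$ is a $K$-module $\mathfrak g$ with a bilinear map $[\ ,\ ]:\mathfrak g\otimes\mathfrak g\to\mathfrak g$ such that for all $u,v,w\in\mathfrak g$, $k\in K$: (i) $k\triangleright[u,v]=[k_{(1)}\triangleright u,k_{(2)}\triangleright v]$; (ii) $[u,v]=-[\mathsf R_\alpha\triangleright v,\mathsf R^\alpha\triangleright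 u]$; (iii) $[u,[v,w]]=[[u,v],w]+[\mathsf R_\alpha\triangleright v,[\mathsf R^\alpha\triangleright u,w]]$. Twist: an invertible $\mathsf F=\mathsf F^\alpha\otimes\mathsf F_\alpha\in K\otimes K$, inverse $\bar{\mathsf F}=\bar{\mathsf F}^\alpha\otimes\bar{\mathsf F}_\alpha$, with $(\varepsilon\otimes\mathrm{id})\mathsf F=1=(\mathrm{id}\otimes\varepsilon)\mathsf F$ and $(\mathsf F\otimes1)(\Delta\otimes\mathrm{id})\mathsf F=(1\otimes\mathsf F)(\mathrm{id}\otimes\Delta)\mathsf F$. $K_{\mathsf F}$ is the Hopf algebra with the algebra and counit of $K$ and coproduct $\Delta_{\mathsf F}(k)=\mathsf F\Delta(k)\bar{\mathsf F}$; it is triangular with $\mathsf R_{\mathsf F}=\mathsf F_{21}\mathsf R\bar{\mathsf F}$. $\mathfrak g_{\mathsf F}$ is the vector space $\mathfrak g$ with the same action, regarded as a $K_{\mathsf F}$-module. *)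

theory Defs
  imports
    "HOL-Library.Poly_Mapping"
    "HOL-Computational_Algebra.Formal_Power_Series"
begin

section \<open>Ground ring\<close>

definition field_or_power_series_ring ::
    "'k::comm_ring_1 itself \<Rightarrow> 'f::field itself \<Rightarrow> bool"
  where
    "field_or_power_series_ring _ _ \<longleftrightarrow>
       (\<forall>x::'k. x \<noteq> 0 \<longrightarrow> x dvd 1) \<or>
       (\<exists>\<phi> :: 'k \<Rightarrow> 'f fps. bij \<phi> \<and>
          (\<forall>x y. \<phi> (x + y) = \<phi> x + \<phi> y) \<and> (\<forall>x y. \<phi> (x * y) = \<phi> x * \<phi> y))"


section \<open>Tensor products\<close>

text \<open>
  The tensor square and the tensor cube of a module are the quotients of the free modules on
  pairs and on triples by the multilinearity relations. A tensor is thus a coset, i.e.\ a set of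
  formal linear combinations.
\<close>

definition free_scale :: "'k::comm_ring_1 \<Rightarrow> ('i \<Rightarrow>\<^sub>0 'k) \<Rightarrow> ('i \<Rightarrow>\<^sub>0 'k)"
  where "free_scale c = Poly_Mapping.map ((*) c)"

abbreviation basis :: "'i \<Rightarrow> ('i \<Rightarrow>\<^sub>0 'k::comm_ring_1)"
  where "basis i \<equiv> Poly_Mapping.single i 1"

lemma lookup_free_scale [simp]:
  "Poly_Mapping.lookup (free_scale c x) i = c * Poly_Mapping.lookup x i"
  unfolding free_scale_def by (simp add: map.rep_eq when_def)

lemma module_free_scale: "module free_scale"
  by unfold_locales (auto intro!: poly_mapping_eqI simp: lookup_add algebra_simps)

definition linear_extension ::
    "('k::comm_ring_1 \<Rightarrow> 'm::ab_group_add \<Rightarrow> 'm) \<Rightarrow> ('i \<Rightarrow> 'm) \<Rightarrow> ('i \<Rightarrow>\<^sub>0 'k) \<Rightarrow> 'm"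
  where "linear_extension s h x =
    (\<Sum>i\<in>Poly_Mapping.keys x. s (Poly_Mapping.lookup x i) (h i))"

definition representative :: "'x set \<Rightarrow> 'x"
  where "representative T = (SOME x. x \<in> T)"

text \<open>
  \<open>sweedler s h T\<close> is the sum of \<open>h T\<^sup>\<alpha> T\<^sub>\<alpha>\<close> for a tensor \<open>T = T\<^sup>\<alpha> \<otimes> T\<^sub>\<alpha>\<close>, taken in the module with
  scalar multiplication \<open>s\<close>. It is computed from an arbitrarily chosen presentation of \<open>T\<close> as a
  linear combination of pure tensors; for bilinear \<open>h\<close> the choice does not matter
  (lemma \<open>sweedler_tensor2\<close> below). When \<open>h\<close> itself takes values in formal linear combinations,
  it is used only inside \<open>tensor2\<close> or \<open>tensor3\<close>, modulo whose relations it is bilinear.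
\<close>

definition sweedler ::
    "('k::comm_ring_1 \<Rightarrow> 'm::ab_group_add \<Rightarrow> 'm) \<Rightarrow> ('a \<Rightarrow> 'a \<Rightarrow> 'm) \<Rightarrow> ('a \<times> 'a \<Rightarrow>\<^sub>0 'k) set \<Rightarrow> 'm"
  where "sweedler s h T = linear_extension s (\<lambda>(a, b). h a b) (representative T)"

definition sweedler3 ::
    "('k::comm_ring_1 \<Rightarrow> 'm::ab_group_add \<Rightarrow> 'm) \<Rightarrow> ('a \<Rightarrow> 'a \<Rightarrow> 'a \<Rightarrow> 'm) \<Rightarrow>
     ('a \<times> 'a \<times> 'a \<Rightarrow>\<^sub>0 'k) set \<Rightarrow> 'm"
  where "sweedler3 s h T = linear_extension s (\<lambda>(a, b, c). h a b c) (representative T)"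

definition bilinear_map ::
    "('k::comm_ring_1 \<Rightarrow> 'a::ab_group_add \<Rightarrow> 'a) \<Rightarrow> ('k \<Rightarrow> 'b::ab_group_add \<Rightarrow> 'b) \<Rightarrow>
     ('k \<Rightarrow> 'c::ab_group_add \<Rightarrow> 'c) \<Rightarrow> ('a \<Rightarrow> 'b \<Rightarrow> 'c) \<Rightarrow> bool"
  where "bilinear_map s1 s2 s3 h \<longleftrightarrow>
    (\<forall>a. module_hom s2 s3 (\<lambda>b. h a b)) \<and> (\<forall>b. module_hom s1 s3 (\<lambda>a. h a b))"


section \<open>Algebras and their tensor powers\<close>

locale algebra_over = module scale
  for scale :: "'k::comm_ring_1 \<Rightarrow> 'a::ring_1 \<Rightarrow> 'a" +
  assumes scale_mult_left: "scale c a * b = scale c (a * b)"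
    and scale_mult_right: "a * scale c b = scale c (a * b)"
begin

definition relations2 :: "('a \<times> 'a \<Rightarrow>\<^sub>0 'k) set"
  where "relations2 = module.span free_scale
    ({basis (a + a', b) - basis (a, b) - basis (a', b) | a a' b. True} \<union>
     {basis (a, b + b') - basis (a, b) - basis (a, b') | a b b'. True} \<union>
     {basis (scale c a, b) - free_scale c (basis (a, b)) | c a b. True} \<union>
     {basis (a, scale c b) - free_scale c (basis (a, b)) | c a b. True})"

definition relations3 :: "('a \<times> 'a \<times> 'a \<Rightarrow>\<^sub>0 'k) set"
  where "relations3 = module.span free_scale
    ({basis (a + a', b, c) - basis (a, b, c) - basis (a', b, c) | a a' b c. True} \<union>
     {basis (a, b + b', c) - basis (a, b, c) - basis (a, b', c) | a b b' c. True} \<union>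
     {basis (a, b, c + c') - basis (a, b, c) - basis (a, b, c') | a b c c'. True} \<union>
     {basis (scale r a, b, c) - free_scale r (basis (a, b, c)) | r a b c. True} \<union>
     {basis (a, scale r b, c) - free_scale r (basis (a, b, c)) | r a b c. True} \<union>
     {basis (a, b, scale r c) - free_scale r (basis (a, b, c)) | r a b c. True})"

definition tensor2 :: "('a \<times> 'a \<Rightarrow>\<^sub>0 'k) \<Rightarrow> ('a \<times> 'a \<Rightarrow>\<^sub>0 'k) set"
  where "tensor2 x = {y. y - x \<in> relations2}"

definition tensor3 :: "('a \<times> 'a \<times> 'a \<Rightarrow>\<^sub>0 'k) \<Rightarrow> ('a \<times> 'a \<times> 'a \<Rightarrow>\<^sub>0 'k) set"
  where "tensor3 x = {y. y - x \<in> relations3}"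

definition tensor_square :: "('a \<times> 'a \<Rightarrow>\<^sub>0 'k) set set"
  where "tensor_square = range tensor2"

definition add2 :: "('a \<times> 'a \<Rightarrow>\<^sub>0 'k) set \<Rightarrow> ('a \<times> 'a \<Rightarrow>\<^sub>0 'k) set \<Rightarrow> ('a \<times> 'a \<Rightarrow>\<^sub>0 'k) set"
  where "add2 S T = tensor2 (representative S + representative T)"

definition scale2 :: "'k \<Rightarrow> ('a \<times> 'a \<Rightarrow>\<^sub>0 'k) set \<Rightarrow> ('a \<times> 'a \<Rightarrow>\<^sub>0 'k) set"
  where "scale2 c T = tensor2 (free_scale c (representative T))"

definition mult2 :: "('a \<times> 'a \<Rightarrow>\<^sub>0 'k) set \<Rightarrow> ('a \<times> 'a \<Rightarrow>\<^sub>0 'k) set \<Rightarrow> ('a \<times> 'a \<Rightarrow>\<^sub>0 'k) set"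
  where "mult2 S T = tensor2
    (sweedler free_scale (\<lambda>a b. sweedler free_scale (\<lambda>c d. basis (a * c, b * d)) T) S)"

definition mult3 ::
    "('a \<times> 'a \<times> 'a \<Rightarrow>\<^sub>0 'k) set \<Rightarrow> ('a \<times> 'a \<times> 'a \<Rightarrow>\<^sub>0 'k) set \<Rightarrow> ('a \<times> 'a \<times> 'a \<Rightarrow>\<^sub>0 'k) set"
  where "mult3 S T = tensor3
    (sweedler3 free_scale (\<lambda>a b c.
       sweedler3 free_scale (\<lambda>a' b' c'. basis (a * a', b * b', c * c')) T) S)"

definition one2 :: "('a \<times> 'a \<Rightarrow>\<^sub>0 'k) set"
  where "one2 = tensor2 (basis (1, 1))"

definition is_inverse2 :: "('a \<times> 'a \<Rightarrow>\<^sub>0 'k) set \<Rightarrow> ('a \<times> 'a \<Rightarrow>\<^sub>0 'k) set \<Rightarrow> bool"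
  where "is_inverse2 S T \<longleftrightarrow> T \<in> tensor_square \<and> mult2 S T = one2 \<and> mult2 T S = one2"

definition invertible2 :: "('a \<times> 'a \<Rightarrow>\<^sub>0 'k) set \<Rightarrow> bool"
  where "invertible2 S \<longleftrightarrow> S \<in> tensor_square \<and> (\<exists>T. is_inverse2 S T)"

definition inverse2 :: "('a \<times> 'a \<Rightarrow>\<^sub>0 'k) set \<Rightarrow> ('a \<times> 'a \<Rightarrow>\<^sub>0 'k) set"
  where "inverse2 S = (THE T. is_inverse2 S T)"

definition flip :: "('a \<times> 'a \<Rightarrow>\<^sub>0 'k) set \<Rightarrow> ('a \<times> 'a \<Rightarrow>\<^sub>0 'k) set"
  where "flip T = tensor2 (sweedler free_scale (\<lambda>a b. basis (b, a)) T)"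

definition leg12 :: "('a \<times> 'a \<Rightarrow>\<^sub>0 'k) set \<Rightarrow> ('a \<times> 'a \<times> 'a \<Rightarrow>\<^sub>0 'k) set"
  where "leg12 T = tensor3 (sweedler free_scale (\<lambda>a b. basis (a, b, 1)) T)"

definition leg13 :: "('a \<times> 'a \<Rightarrow>\<^sub>0 'k) set \<Rightarrow> ('a \<times> 'a \<times> 'a \<Rightarrow>\<^sub>0 'k) set"
  where "leg13 T = tensor3 (sweedler free_scale (\<lambda>a b. basis (a, 1, b)) T)"

definition leg23 :: "('a \<times> 'a \<Rightarrow>\<^sub>0 'k) set \<Rightarrow> ('a \<times> 'a \<times> 'a \<Rightarrow>\<^sub>0 'k) set"
  where "leg23 T = tensor3 (sweedler free_scale (\<lambda>a b. basis (1, a, b)) T)"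

text \<open>The maps \<open>\<Delta> \<otimes> id\<close> and \<open>id \<otimes> \<Delta>\<close> from the tensor square to the tensor cube.\<close>

definition map_left ::
    "('a \<Rightarrow> ('a \<times> 'a \<Rightarrow>\<^sub>0 'k) set) \<Rightarrow> ('a \<times> 'a \<Rightarrow>\<^sub>0 'k) set \<Rightarrow> ('a \<times> 'a \<times> 'a \<Rightarrow>\<^sub>0 'k) set"
  where "map_left \<Delta> T = tensor3
    (sweedler free_scale (\<lambda>a b. sweedler free_scale (\<lambda>c d. basis (c, d, b)) (\<Delta> a)) T)"

definition map_right ::
    "('a \<Rightarrow> ('a \<times> 'a \<Rightarrow>\<^sub>0 'k) set) \<Rightarrow> ('a \<times> 'a \<Rightarrow>\<^sub>0 'k) set \<Rightarrow> ('a \<times> 'a \<times> 'a \<Rightarrow>\<^sub>0 'k) set"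
  where "map_right \<Delta> T = tensor3
    (sweedler free_scale (\<lambda>a b. sweedler free_scale (\<lambda>c d. basis (a, c, d)) (\<Delta> b)) T)"

lemma sweedler_tensor2:
  assumes s: "module s" and h: "bilinear_map scale scale s h"
  shows "sweedler s h (tensor2 x) = linear_extension s (\<lambda>(a, b). h a b) x"
proof -
  interpret free: module free_scale by (rule module_free_scale)
  interpret s: module s by (rule s)
  let ?L = "linear_extension s (\<lambda>(a, b). h a b)"
  have superset: "?L x = (\<Sum>i\<in>A. s (Poly_Mapping.lookup x i) (case i of (a, b) \<Rightarrow> h a b))"
    if "finite A" "Poly_Mapping.keys x \<subseteq> A" for A x
    unfolding linear_extension_def using that
    by (intro sum.mono_neutral_left) (auto simp: in_keys_iff s.scale_zero_left)
  have add: "?L (x + y) = ?L x + ?L y" for x y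
    by (subst (1 2 3) superset[of "Poly_Mapping.keys x \<union> Poly_Mapping.keys y"])
      (auto simp: Poly_Mapping.keys_add[THEN subsetD] lookup_add s.scale_left_distrib sum.distrib
            dest: Poly_Mapping.keys_add[THEN subsetD])
  have scl: "?L (free_scale c x) = s c (?L x)" for c x
    by (subst (1 2) superset[of "Poly_Mapping.keys x"])
      (auto simp: in_keys_iff s.scale_sum_right)
  have hom: "module_hom free_scale s ?L"
    by unfold_locales (auto simp: add scl)
  interpret L: module_hom free_scale s ?L by (rule hom)
  have single: "?L (basis (a, b)) = h a b" for a b
    by (simp add: linear_extension_def)
  have h1: "module_hom scale s (\<lambda>b. h a b)" and h2: "module_hom scale s (\<lambda>a. h a b)" for a b
    using h by (auto simp: bilinear_map_def)
  have vanish: "?L r = 0" if "r \<in> relations2" for r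
    using that unfolding relations2_def
  proof (rule free.span_induct)
    show "free.subspace {r. ?L r = 0}"
      by (auto simp: free.subspace_def L.add L.scale)
  qed (auto simp: L.diff L.scale single h1[THEN module_hom.add] h2[THEN module_hom.add]
        h1[THEN module_hom.scale] h2[THEN module_hom.scale])
  have "x \<in> tensor2 x"
    by (simp add: tensor2_def relations2_def free.span_zero)
  then have "representative (tensor2 x) \<in> tensor2 x"
    unfolding representative_def by (rule someI)
  then have "?L (representative (tensor2 x) - x) = 0"
    by (intro vanish) (simp add: tensor2_def)
  then show ?thesis
    by (simp add: sweedler_def L.diff)
qed

end


section \<open>Triangular Hopf algebras\<close>

locale bialgebra = algebra_over scale
  for scale :: "'k::comm_ring_1 \<Rightarrow> 'a::ring_1 \<Rightarrow> 'a" +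
  fixes comult :: "'a \<Rightarrow> ('a \<times> 'a \<Rightarrow>\<^sub>0 'k) set" (\<open>\<Delta>\<close>)
    and counit :: "'a \<Rightarrow> 'k" (\<open>\<epsilon>\<close>)
  assumes comult_in: "\<Delta> x \<in> tensor_square"
    and comult_add: "\<Delta> (x + y) = add2 (\<Delta> x) (\<Delta> y)"
    and comult_scale: "\<Delta> (scale c x) = scale2 c (\<Delta> x)"
    and comult_mult: "\<Delta> (x * y) = mult2 (\<Delta> x) (\<Delta> y)"
    and comult_one: "\<Delta> 1 = one2"
    and counit_linear: "module_hom scale (*) \<epsilon>"
    and counit_mult: "\<epsilon> (x * y) = \<epsilon> x * \<epsilon> y"
    and counit_one: "\<epsilon> 1 = 1"
    and coassoc: "map_left \<Delta> (\<Delta> x) = map_right \<Delta> (\<Delta> x)"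
    and counit_left: "sweedler scale (\<lambda>a b. scale (\<epsilon> a) b) (\<Delta> x) = x"
    and counit_right: "sweedler scale (\<lambda>a b. scale (\<epsilon> b) a) (\<Delta> x) = x"

locale hopf_algebra = bialgebra scale comult counit
  for scale :: "'k::comm_ring_1 \<Rightarrow> 'a::ring_1 \<Rightarrow> 'a"
    and comult :: "'a \<Rightarrow> ('a \<times> 'a \<Rightarrow>\<^sub>0 'k) set" (\<open>\<Delta>\<close>)
    and counit :: "'a \<Rightarrow> 'k" (\<open>\<epsilon>\<close>) +
  assumes antipode: "\<exists>S. module_hom scale scale S \<and>
    (\<forall>x. sweedler scale (\<lambda>a b. S a * b) (\<Delta> x) = scale (\<epsilon> x) 1 \<and>
         sweedler scale (\<lambda>a b. a * S b) (\<Delta> x) = scale (\<epsilon> x) 1)"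

locale triangular_hopf_algebra = hopf_algebra scale comult counit
  for scale :: "'k::comm_ring_1 \<Rightarrow> 'a::ring_1 \<Rightarrow> 'a"
    and comult :: "'a \<Rightarrow> ('a \<times> 'a \<Rightarrow>\<^sub>0 'k) set" (\<open>\<Delta>\<close>)
    and counit :: "'a \<Rightarrow> 'k" (\<open>\<epsilon>\<close>) +
  fixes R :: "('a \<times> 'a \<Rightarrow>\<^sub>0 'k) set"
  assumes R_invertible: "invertible2 R"
    and R_comult: "flip (\<Delta> x) = mult2 (mult2 R (\<Delta> x)) (inverse2 R)"
    and R_comult_left: "map_left \<Delta> R = mult3 (leg13 R) (leg23 R)"
    and R_comult_right: "map_right \<Delta> R = mult3 (leg13 R) (leg12 R)"
    and R_triangular: "inverse2 R = flip R"


section \<open>Braided Lie algebras\<close>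

locale hopf_module = hopf_algebra scale comult counit + g: module scale_g
  for scale :: "'k::comm_ring_1 \<Rightarrow> 'a::ring_1 \<Rightarrow> 'a"
    and comult :: "'a \<Rightarrow> ('a \<times> 'a \<Rightarrow>\<^sub>0 'k) set" (\<open>\<Delta>\<close>)
    and counit :: "'a \<Rightarrow> 'k" (\<open>\<epsilon>\<close>)
    and scale_g :: "'k \<Rightarrow> 'g::ab_group_add \<Rightarrow> 'g" +
  fixes act :: "'a \<Rightarrow> 'g \<Rightarrow> 'g" (infixr \<open>\<triangleright>\<close> 75)
  assumes act_bilinear: "bilinear_map scale scale_g scale_g act"
    and act_one: "1 \<triangleright> u = u"
    and act_mult: "(x * y) \<triangleright> u = x \<triangleright> y \<triangleright> u"

locale braided_lie_algebra =
  triangular_hopf_algebra scale comult counit R + hopf_module scale comult counit scale_g act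
  for scale :: "'k::comm_ring_1 \<Rightarrow> 'a::ring_1 \<Rightarrow> 'a"
    and comult :: "'a \<Rightarrow> ('a \<times> 'a \<Rightarrow>\<^sub>0 'k) set" (\<open>\<Delta>\<close>)
    and counit :: "'a \<Rightarrow> 'k" (\<open>\<epsilon>\<close>)
    and R :: "('a \<times> 'a \<Rightarrow>\<^sub>0 'k) set"
    and scale_g :: "'k \<Rightarrow> 'g::ab_group_add \<Rightarrow> 'g"
    and act :: "'a \<Rightarrow> 'g \<Rightarrow> 'g" (infixr \<open>\<triangleright>\<close> 75) +
  fixes bracket :: "'g \<Rightarrow> 'g \<Rightarrow> 'g"
  assumes bracket_bilinear: "bilinear_map scale_g scale_g scale_g bracket"
    and bracket_equivariant:
      "x \<triangleright> bracket u v = sweedler scale_g (\<lambda>a b. bracket (a \<triangleright> u) (b \<triangleright> v)) (\<Delta> x)"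
    and bracket_antisymmetric:
      "bracket u v = - sweedler scale_g (\<lambda>a b. bracket (b \<triangleright> v) (a \<triangleright> u)) R"
    and bracket_jacobi:
      "bracket u (bracket v w) = bracket (bracket u v) w +
         sweedler scale_g (\<lambda>a b. bracket (b \<triangleright> v) (bracket (a \<triangleright> u) w)) R"


section \<open>Twists\<close>

locale hopf_twist = hopf_algebra scale comult counit
  for scale :: "'k::comm_ring_1 \<Rightarrow> 'a::ring_1 \<Rightarrow> 'a"
    and comult :: "'a \<Rightarrow> ('a \<times> 'a \<Rightarrow>\<^sub>0 'k) set" (\<open>\<Delta>\<close>)
    and counit :: "'a \<Rightarrow> 'k" (\<open>\<epsilon>\<close>) +
  fixes F :: "('a \<times> 'a \<Rightarrow>\<^sub>0 'k) set"
  assumes F_invertible: "invertible2 F"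
    and F_counit_left: "sweedler scale (\<lambda>a b. scale (\<epsilon> a) b) F = 1"
    and F_counit_right: "sweedler scale (\<lambda>a b. scale (\<epsilon> b) a) F = 1"
    and F_cocycle: "mult3 (leg12 F) (map_left \<Delta> F) = mult3 (leg23 F) (map_right \<Delta> F)"

context algebra_over
begin

definition twisted_comult ::
    "('a \<times> 'a \<Rightarrow>\<^sub>0 'k) set \<Rightarrow> ('a \<Rightarrow> ('a \<times> 'a \<Rightarrow>\<^sub>0 'k) set) \<Rightarrow> 'a \<Rightarrow> ('a \<times> 'a \<Rightarrow>\<^sub>0 'k) set"
  where "twisted_comult F \<Delta> x = mult2 (mult2 F (\<Delta> x)) (inverse2 F)"

definition twisted_R ::
    "('a \<times> 'a \<Rightarrow>\<^sub>0 'k) set \<Rightarrow> ('a \<times> 'a \<Rightarrow>\<^sub>0 'k) set \<Rightarrow> ('a \<times> 'a \<Rightarrow>\<^sub>0 'k) set"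
  where "twisted_R F R = mult2 (mult2 (flip F) R) (inverse2 F)"

definition twisted_bracket ::
    "('a \<times> 'a \<Rightarrow>\<^sub>0 'k) set \<Rightarrow> ('k \<Rightarrow> 'g::ab_group_add \<Rightarrow> 'g) \<Rightarrow> ('a \<Rightarrow> 'g \<Rightarrow> 'g) \<Rightarrow>
     ('g \<Rightarrow> 'g \<Rightarrow> 'g) \<Rightarrow> 'g \<Rightarrow> 'g \<Rightarrow> 'g"
  where "twisted_bracket F scale_g act bracket u v =
    sweedler scale_g (\<lambda>a b. bracket (act a u) (act b v)) (inverse2 F)"

end

end

theory Submission
  imports Defs
begin

text \<open>
  Write \<open>G = F\<inverse>\<close> and, for a tensor \<open>T\<close>, \<open>T\<^sub>2\<^sub>1\<close> for its flip. The idea is that \<open>K \<otimes> K\<close> acts on the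
  bilinear maps \<open>\<beta> : g \<times> g \<rightarrow> g\<close> by \<open>(T \<cdot> \<beta>)(u, v) = \<beta>(T\<^sup>\<alpha> \<triangleright> u, T\<^sub>\<alpha> \<triangleright> v)\<close>, and \<open>K \<otimes> K \<otimes> K\<close>
  acts likewise on trilinear maps; these are right actions (\<open>act2_act2\<close>, \<open>act3_act3\<close>). In this
  language the twisted bracket is \<open>G \<cdot> [ , ]\<close>, the axioms of a braided Lie algebra say

    \<open>x \<triangleright> \<beta>(u, v) = (\<Delta> x \<cdot> \<beta>)(u, v)\<close>, \<open>\<beta> = - R \<cdot> \<beta>\<^sup>o\<^sup>p\<close> and \<open>\<beta>(u, \<beta>(v, w)) = \<beta>(\<beta>(u, v), w) + (R\<^sub>1\<^sub>2 \<cdot> \<sigma>)(u, v, w)\<close>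

  where \<open>\<beta>\<^sup>o\<^sup>p(u, v) = \<beta>(v, u)\<close> and \<open>\<sigma>(u, v, w) = \<beta>(v, \<beta>(u, w))\<close>, and each of them is carried from
  \<open>[ , ]\<close> to the twisted bracket by one identity between words in \<open>K \<otimes> K\<close> or \<open>K \<otimes> K \<otimes> K\<close>.

  Equivariance and antisymmetry use \<open>\<Delta> x G = G \<Delta>\<^sub>F x\<close> and \<open>R G = G\<^sub>2\<^sub>1 R\<^sub>F\<close>. For the Jacobi identity,
  equivariance of \<open>[ , ]\<close> shows that the twisted nested brackets \<open>[u, [v, w]]\<close> and \<open>[[u, v], w]\<close> arise
  from the untwisted ones by acting with \<open>(id \<otimes> \<Delta>)(G) G\<^sub>2\<^sub>3\<close> and \<open>(\<Delta> \<otimes> id)(G) G\<^sub>1\<^sub>2\<close> respectively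
  (\<open>act2_nested_right\<close>, \<open>act2_nested_left\<close>). By the cocycle condition for \<open>F\<close> these are the same
  element \<open>\<Phi>\<close> of \<open>K \<otimes> K \<otimes> K\<close> (\<open>inverse_cocycle\<close>). Exchanging the first two factors of \<open>\<Phi>\<close> gives
  \<open>\<Phi>\<^sub>2\<^sub>1\<^sub>3\<close> with \<open>\<Phi>\<^sub>2\<^sub>1\<^sub>3 (R\<^sub>F)\<^sub>1\<^sub>2 = R\<^sub>1\<^sub>2 \<Phi>\<close>, because \<open>R\<close> conjugates \<open>\<Delta>\<close> into its opposite; so acting
  with \<open>\<Phi>\<close> turns the Jacobi identity of \<open>[ , ]\<close> into that of the twisted bracket
  (\<open>bracket_F_jacobi\<close>).

  The other half of the theorem is that \<open>K\<^sub>F\<close> with \<open>R\<^sub>F\<close> is again a triangular Hopf algebra. Almost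
  everything there is a word computation in the monoids \<open>K \<otimes> K\<close> and \<open>K \<otimes> K \<otimes> K\<close>, resting on one
  intertwining principle (\<open>map_left_intertwine\<close>): if \<open>D'(a) Y = Y' D(a)\<close> for all \<open>a\<close>, then
  \<open>(D' \<otimes> id)(T) Y\<^sub>1\<^sub>2 = Y'\<^sub>1\<^sub>2 (D \<otimes> id)(T)\<close>. It expresses \<open>\<Delta>\<^sub>F \<otimes> id\<close> through \<open>\<Delta> \<otimes> id\<close> and lets \<open>R\<close> move past
  a coproduct. The antipode of \<open>K\<^sub>F\<close> is \<open>x \<mapsto> U S(x) U\<inverse>\<close> with \<open>U = F\<^sup>\<alpha> S(F\<^sub>\<alpha>)\<close>
  (\<open>antipode_comult_F\<close>).
\<close>

section \<open>Linear extensions\<close>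

lemma linear_extension_superset:
  assumes "module s" "finite A" "Poly_Mapping.keys x \<subseteq> A"
  shows "linear_extension s h x = (\<Sum>i\<in>A. s (Poly_Mapping.lookup x i) (h i))"
proof -
  interpret module s by fact
  show ?thesis
    unfolding linear_extension_def using assms
    by (intro sum.mono_neutral_left) (auto simp: in_keys_iff)
qed

lemma linear_extension_hom:
  assumes "module s"
  shows "module_hom free_scale s (linear_extension s h)"
proof -
  interpret free: module free_scale by (rule module_free_scale)
  interpret s: module s by fact
  show ?thesis
  proof unfold_locales
    fix x y
    show "linear_extension s h (x + y) = linear_extension s h x + linear_extension s h y"
      by (subst (1 2 3) linear_extension_superset[OF assms,
            of "Poly_Mapping.keys x \<union> Poly_Mapping.keys y"])
        (auto simp: lookup_add s.scale_left_distrib sum.distrib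
            dest: Poly_Mapping.keys_add[THEN subsetD])
  next
    fix c x
    show "linear_extension s h (free_scale c x) = s c (linear_extension s h x)"
      by (subst (1 2) linear_extension_superset[OF assms, of "Poly_Mapping.keys x"])
        (auto simp: in_keys_iff s.scale_sum_right)
  qed
qed

lemmas linear_extension_add = linear_extension_hom[THEN module_hom.add]
  and linear_extension_scale = linear_extension_hom[THEN module_hom.scale]
  and linear_extension_diff = linear_extension_hom[THEN module_hom.diff]

lemma linear_extension_basis:
  assumes "module s"
  shows "linear_extension s h (basis i) = h i"
proof -
  interpret module s by fact
  show ?thesis by (simp add: linear_extension_def)
qed

lemma module_hom_linear_extension:
  assumes "module_hom s t L"
  shows "L (linear_extension s h x) = linear_extension t (\<lambda>i. L (h i)) x"
proof -
  interpret module_hom s t L by fact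
  show ?thesis by (simp add: linear_extension_def sum scale)
qed

text \<open>
  Finite sums may be exchanged. This holds for arbitrary \<open>h\<close>, which is why nested Sweedler sums
  over independent tensors can later be reordered freely.
\<close>

lemma linear_extension_swap:
  assumes "module s"
  shows "linear_extension s (\<lambda>i. linear_extension s (\<lambda>j. h i j) y) x =
    linear_extension s (\<lambda>j. linear_extension s (\<lambda>i. h i j) x) y"
proof -
  interpret module s by fact
  show ?thesis
    unfolding linear_extension_def scale_sum_right
    by (subst sum.swap) (simp add: mult.commute)
qed

lemma linear_extension_add_fun:
  assumes "module s"
  shows "linear_extension s (\<lambda>i. h i + h' i) x = linear_extension s h x + linear_extension s h' x"
proof -
  interpret module s by fact
  show ?thesis by (simp add: linear_extension_def scale_right_distrib sum.distrib)
qed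

lemma linear_extension_diff_fun:
  assumes "module s"
  shows "linear_extension s (\<lambda>i. h i - h' i) x = linear_extension s h x - linear_extension s h' x"
proof -
  interpret module s by fact
  show ?thesis by (simp add: linear_extension_def scale_right_diff_distrib sum_subtractf)
qed

lemma linear_extension_scale_fun:
  assumes "module s"
  shows "linear_extension s (\<lambda>i. s c (h i)) x = s c (linear_extension s h x)"
proof -
  interpret module s by fact
  show ?thesis by (simp add: linear_extension_def scale_sum_right mult.commute)
qed

lemma free_expansion: "linear_extension free_scale basis x = x"
proof (rule poly_mapping_eqI)
  fix k
  have "Poly_Mapping.lookup (linear_extension free_scale basis x) k =
    (\<Sum>i\<in>Poly_Mapping.keys x. Poly_Mapping.lookup x i * (1 when i = k))"
    by (simp add: linear_extension_def lookup_sum lookup_single)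
  also have "\<dots> = (\<Sum>i\<in>Poly_Mapping.keys x. (if i = k then Poly_Mapping.lookup x i else 0))"
    by (intro sum.cong) (auto simp: when_def)
  finally show "Poly_Mapping.lookup (linear_extension free_scale basis x) k = Poly_Mapping.lookup x k"
    by (simp add: in_keys_iff)
qed

lemma module_hom_free_expansion:
  assumes "module_hom free_scale s L"
  shows "L x = linear_extension s (\<lambda>i. L (basis i)) x"
  using module_hom_linear_extension[OF assms, of basis x] by (simp add: free_expansion)

lemma linear_extension_mem:
  assumes "module s" "module.subspace s N" "\<And>i. h i \<in> N"
  shows "linear_extension s h x \<in> N"
proof -
  interpret module s by fact
  show ?thesis
    using assms by (auto simp: linear_extension_def intro!: subspace_sum subspace_scale)
qed

lemmas free_simps =
  linear_extension_add[OF module_free_scale] linear_extension_scale[OF module_free_scale]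
  linear_extension_diff[OF module_free_scale] linear_extension_basis[OF module_free_scale]

lemma linear_extension_comp:
  assumes "module s"
  shows "linear_extension s h (linear_extension free_scale f x) =
    linear_extension s (\<lambda>i. linear_extension s h (f i)) x"
  by (rule module_hom_linear_extension[OF linear_extension_hom[OF assms]])


section \<open>Residue classes modulo a submodule of a free module\<close>

text \<open>
  The tensor square and the tensor cube are both quotients of a free module by a submodule \<open>N\<close>, so
  their common part is developed for residue classes of an arbitrary \<open>N\<close>. All operations read off
  the chosen representative of a class. Hence many laws hold for every set in place of a class:
  the representative of any set is just some element of the free module.
\<close>

definition residue_class :: "('i \<Rightarrow>\<^sub>0 'k::comm_ring_1) set \<Rightarrow> ('i \<Rightarrow>\<^sub>0 'k) \<Rightarrow> ('i \<Rightarrow>\<^sub>0 'k) set"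
  where "residue_class N x = {y. y - x \<in> N}"

definition class_add ::
    "('i \<Rightarrow>\<^sub>0 'k::comm_ring_1) set \<Rightarrow> ('i \<Rightarrow>\<^sub>0 'k) set \<Rightarrow> ('i \<Rightarrow>\<^sub>0 'k) set \<Rightarrow> ('i \<Rightarrow>\<^sub>0 'k) set"
  where "class_add N S T = residue_class N (representative S + representative T)"

definition class_scale ::
    "('i \<Rightarrow>\<^sub>0 'k::comm_ring_1) set \<Rightarrow> 'k \<Rightarrow> ('i \<Rightarrow>\<^sub>0 'k) set \<Rightarrow> ('i \<Rightarrow>\<^sub>0 'k) set"
  where "class_scale N c T = residue_class N (free_scale c (representative T))"

definition induced ::
    "('j \<Rightarrow>\<^sub>0 'k::comm_ring_1) set \<Rightarrow> ('i \<Rightarrow> ('j \<Rightarrow>\<^sub>0 'k)) \<Rightarrow> ('i \<Rightarrow>\<^sub>0 'k) set \<Rightarrow> ('j \<Rightarrow>\<^sub>0 'k) set"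
  where "induced N f T = residue_class N (linear_extension free_scale f (representative T))"

abbreviation free_subspace :: "('i \<Rightarrow>\<^sub>0 'k::comm_ring_1) set \<Rightarrow> bool"
  where "free_subspace \<equiv> module.subspace free_scale"

text \<open>
  The linear map that extends \<open>f\<close> descends to the quotients by \<open>N\<close> and \<open>N'\<close>.
\<close>

definition preserves ::
    "('i \<Rightarrow>\<^sub>0 'k::comm_ring_1) set \<Rightarrow> ('j \<Rightarrow>\<^sub>0 'k) set \<Rightarrow> ('i \<Rightarrow> ('j \<Rightarrow>\<^sub>0 'k)) \<Rightarrow> bool"
  where "preserves N N' f \<longleftrightarrow> (\<forall>x\<in>N. linear_extension free_scale f x \<in> N')"

lemma residue_class_eq_iff:
  assumes "free_subspace N"
  shows "residue_class N x = residue_class N y \<longleftrightarrow> x - y \<in> N"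
proof -
  interpret module free_scale by (rule module_free_scale)
  show ?thesis
  proof
    assume "residue_class N x = residue_class N y"
    moreover have "x \<in> residue_class N x"
      using subspace_0[OF assms] by (simp add: residue_class_def)
    ultimately show "x - y \<in> N" by (simp add: residue_class_def)
  next
    assume xy: "x - y \<in> N"
    have "z - y \<in> N" if "z - x \<in> N" for z
      using subspace_add[OF assms that xy] by simp
    moreover have "z - x \<in> N" if "z - y \<in> N" for z
      using subspace_diff[OF assms that xy] by simp
    ultimately show "residue_class N x = residue_class N y"
      by (auto simp: residue_class_def)
  qed
qed

lemma representative_residue_class:
  assumes "free_subspace N"
  shows "representative (residue_class N x) - x \<in> N"
proof -
  interpret module free_scale by (rule module_free_scale)
  have "x \<in> residue_class N x"
    using subspace_0[OF assms] by (simp add: residue_class_def)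
  then have "representative (residue_class N x) \<in> residue_class N x"
    unfolding representative_def by (rule someI)
  then show ?thesis by (simp add: residue_class_def)
qed

lemma residue_class_representative:
  assumes "free_subspace N" "T \<in> range (residue_class N)"
  shows "residue_class N (representative T) = T"
  using assms representative_residue_class residue_class_eq_iff by blast

lemma residue_class_cong_linear_extension:
  assumes "free_subspace N" "\<And>i. residue_class N (f i) = residue_class N (g i)"
  shows "residue_class N (linear_extension free_scale f x) =
    residue_class N (linear_extension free_scale g x)"
  using assms
  by (simp add: residue_class_eq_iff linear_extension_mem module_free_scale
      flip: linear_extension_diff_fun[OF module_free_scale])

lemma induced_cong:
  assumes "free_subspace N" "\<And>i. residue_class N (f i) = residue_class N (g i)"
  shows "induced N f T = induced N g T"
  unfolding induced_def by (rule residue_class_cong_linear_extension[OF assms])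

lemma induced_residue_class:
  assumes "free_subspace N" "free_subspace N'" "preserves N N' f"
  shows "induced N' f (residue_class N x) = residue_class N' (linear_extension free_scale f x)"
  using assms representative_residue_class[OF assms(1), of x]
  by (auto simp: induced_def residue_class_eq_iff preserves_def
      simp flip: linear_extension_diff[OF module_free_scale])

lemma induced_induced:
  assumes "free_subspace N'" "free_subspace N''" "preserves N' N'' g"
  shows "induced N'' g (induced N' f T) =
    induced N'' (\<lambda>i. linear_extension free_scale g (f i)) T"
proof -
  have "induced N'' g (induced N' f T) =
      residue_class N'' (linear_extension free_scale g (linear_extension free_scale f (representative T)))"
    using induced_residue_class[OF assms] by (simp add: induced_def[of N' f])
  then show ?thesis
    by (simp add: induced_def linear_extension_comp[OF module_free_scale])
qed

lemma class_add_residue_class: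
  assumes "free_subspace N"
  shows "class_add N (residue_class N x) (residue_class N y) = residue_class N (x + y)"
proof -
  interpret module free_scale by (rule module_free_scale)
  from subspace_add[OF assms representative_residue_class[OF assms, of x]
      representative_residue_class[OF assms, of y]]
  show ?thesis
    by (simp add: class_add_def residue_class_eq_iff[OF assms] algebra_simps)
qed

lemma class_scale_residue_class:
  assumes "free_subspace N"
  shows "class_scale N c (residue_class N x) = residue_class N (free_scale c x)"
proof -
  interpret module free_scale by (rule module_free_scale)
  from subspace_scale[OF assms representative_residue_class[OF assms, of x], of c]
  show ?thesis
    by (simp add: class_scale_def residue_class_eq_iff[OF assms] scale_right_diff_distrib)
qed

lemma induced_class_add:
  assumes "free_subspace N" "free_subspace N'" "preserves N N' f"
  shows "induced N' f (class_add N S T) = class_add N' (induced N' f S) (induced N' f T)"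
proof -
  have "induced N' f (class_add N S T) =
      residue_class N' (linear_extension free_scale f (representative S + representative T))"
    unfolding class_add_def by (rule induced_residue_class[OF assms])
  also have "\<dots> = class_add N' (induced N' f S) (induced N' f T)"
    unfolding induced_def class_add_residue_class[OF assms(2)] by (simp add: free_simps)
  finally show ?thesis .
qed

lemma induced_class_scale:
  assumes "free_subspace N" "free_subspace N'" "preserves N N' f"
  shows "induced N' f (class_scale N c T) = class_scale N' c (induced N' f T)"
proof -
  have "induced N' f (class_scale N c T) =
      residue_class N' (linear_extension free_scale f (free_scale c (representative T)))"
    unfolding class_scale_def by (rule induced_residue_class[OF assms])
  also have "\<dots> = class_scale N' c (induced N' f T)"
    unfolding induced_def class_scale_residue_class[OF assms(2)] by (simp add: free_simps)
  finally show ?thesis .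
qed


section \<open>Quotients of monoid algebras\<close>

text \<open>
  Both \<open>K \<otimes> K\<close> and \<open>K \<otimes> K \<otimes> K\<close> are quotients of the monoid algebra of \<open>K \<times> K\<close>, respectively
  \<open>K \<times> K \<times> K\<close>, under componentwise multiplication, by a two-sided ideal. The monoid algebra is
  strictly associative, so that associativity and multiplicativity of maps are checked on basis
  elements.
\<close>

definition convolution ::
    "('i \<Rightarrow> 'i \<Rightarrow> 'i) \<Rightarrow> ('i \<Rightarrow>\<^sub>0 'k::comm_ring_1) \<Rightarrow> ('i \<Rightarrow>\<^sub>0 'k) \<Rightarrow> ('i \<Rightarrow>\<^sub>0 'k)"
  where "convolution m x y =
    linear_extension free_scale (\<lambda>i. linear_extension free_scale (\<lambda>j. basis (m i j)) y) x"

lemma convolution_hom_left: "module_hom free_scale free_scale (\<lambda>x. convolution m x y)"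
  unfolding convolution_def by (rule linear_extension_hom[OF module_free_scale])

lemma convolution_eq_swap:
  "convolution m x y =
    linear_extension free_scale (\<lambda>j. linear_extension free_scale (\<lambda>i. basis (m i j)) x) y"
  unfolding convolution_def by (rule linear_extension_swap[OF module_free_scale])

lemma convolution_hom_right: "module_hom free_scale free_scale (\<lambda>y. convolution m x y)"
  unfolding convolution_eq_swap by (rule linear_extension_hom[OF module_free_scale])

lemma convolution_basis: "convolution m (basis i) (basis j) = basis (m i j)"
  by (simp add: convolution_def free_simps)

lemma convolution_expand_left:
  "convolution m x y = linear_extension free_scale (\<lambda>i. convolution m (basis i) y) x"
  by (rule module_hom_free_expansion[OF convolution_hom_left])

lemma convolution_expand_right:
  "convolution m x y = linear_extension free_scale (\<lambda>j. convolution m x (basis j)) y"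
  by (rule module_hom_free_expansion[OF convolution_hom_right])

lemma linear_extension_convolution:
  assumes "module s"
  shows "linear_extension s h (convolution m x y) =
    linear_extension s (\<lambda>i. linear_extension s (\<lambda>j. h (m i j)) y) x"
  by (simp add: convolution_def linear_extension_comp[OF assms] linear_extension_basis[OF assms])

locale monoid_algebra_ideal =
  fixes m :: "'i \<Rightarrow> 'i \<Rightarrow> 'i" and e :: 'i and N :: "('i \<Rightarrow>\<^sub>0 'k::comm_ring_1) set"
  assumes m_assoc: "m (m i j) k = m i (m j k)"
    and m_e_left: "m e i = i"
    and m_e_right: "m i e = i"
    and N_subspace: "free_subspace N"
    and N_left: "x \<in> N \<Longrightarrow> convolution m (basis i) x \<in> N"
    and N_right: "x \<in> N \<Longrightarrow> convolution m x (basis i) \<in> N"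
begin

definition mult :: "('i \<Rightarrow>\<^sub>0 'k) set \<Rightarrow> ('i \<Rightarrow>\<^sub>0 'k) set \<Rightarrow> ('i \<Rightarrow>\<^sub>0 'k) set"
  where "mult S T = residue_class N (convolution m (representative S) (representative T))"

lemma ideal_left: "y \<in> N \<Longrightarrow> convolution m x y \<in> N"
  by (subst convolution_expand_left)
    (auto intro!: linear_extension_mem N_subspace N_left module_free_scale)

lemma ideal_right: "x \<in> N \<Longrightarrow> convolution m x y \<in> N"
  by (subst convolution_expand_right)
    (auto intro!: linear_extension_mem N_subspace N_right module_free_scale)

lemma convolution_assoc:
  "convolution m (convolution m x y) z = convolution m x (convolution m y z)"
  by (simp add: convolution_def linear_extension_comp[OF module_free_scale] free_simps m_assoc)

lemma mult_residue_class_left: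
  "mult (residue_class N x) T = residue_class N (convolution m x (representative T))"
  using ideal_right[OF representative_residue_class[OF N_subspace]]
  by (simp add: mult_def residue_class_eq_iff[OF N_subspace]
      flip: convolution_hom_left[THEN module_hom.diff])

lemma mult_residue_class_right:
  "mult S (residue_class N y) = residue_class N (convolution m (representative S) y)"
  using ideal_left[OF representative_residue_class[OF N_subspace]]
  by (simp add: mult_def residue_class_eq_iff[OF N_subspace]
      flip: convolution_hom_right[THEN module_hom.diff])

lemma mult_residue_class:
  "mult (residue_class N x) (residue_class N y) = residue_class N (convolution m x y)"
  unfolding mult_residue_class_left
  using ideal_left[OF representative_residue_class[OF N_subspace]]
  by (simp add: residue_class_eq_iff[OF N_subspace]
      flip: convolution_hom_right[THEN module_hom.diff])

text \<open>
  No side condition: a product depends on its arguments only through their representatives, and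
  a product of classes may be computed with any representative.
\<close>

lemma mult_assoc: "mult (mult S T) U = mult S (mult T U)"
  by (simp add: mult_def[of S T] mult_def[of T U] mult_residue_class_left
      mult_residue_class_right convolution_assoc)

lemma mult_one_left: "T \<in> range (residue_class N) \<Longrightarrow> mult (residue_class N (basis e)) T = T"
  by (auto simp: mult_residue_class convolution_def m_e_left free_simps free_expansion)

lemma mult_one_right: "T \<in> range (residue_class N) \<Longrightarrow> mult T (residue_class N (basis e)) = T"
  by (auto simp: mult_residue_class convolution_def m_e_right free_simps free_expansion)

lemma mult_class_add_left:
  "mult (class_add N S T) U = class_add N (mult S U) (mult T U)"
  by (simp add: mult_def[of S U] mult_def[of T U] class_add_residue_class[OF N_subspace]
      class_add_def[of N S T] mult_residue_class_left convolution_hom_left[THEN module_hom.add])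

lemma mult_class_add_right:
  "mult U (class_add N S T) = class_add N (mult U S) (mult U T)"
  by (simp add: mult_def[of U S] mult_def[of U T] class_add_residue_class[OF N_subspace]
      class_add_def[of N S T] mult_residue_class_right convolution_hom_right[THEN module_hom.add])

lemma mult_class_scale_left:
  "mult (class_scale N c S) U = class_scale N c (mult S U)"
  by (simp add: mult_def[of S U] class_scale_residue_class[OF N_subspace]
      class_scale_def[of N c S] mult_residue_class_left convolution_hom_left[THEN module_hom.scale])

lemma mult_class_scale_right:
  "mult U (class_scale N c S) = class_scale N c (mult U S)"
  by (simp add: mult_def[of U S] class_scale_residue_class[OF N_subspace]
      class_scale_def[of N c S] mult_residue_class_right convolution_hom_right[THEN module_hom.scale])

end

text \<open>
  Multiplicativity need only be checked on basis elements. Three different maps are allowed since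
  \<open>T \<mapsto> T \<otimes> c\<close> sends a product to a product only in the form
  \<open>S T \<otimes> c d = (S \<otimes> c) (T \<otimes> d)\<close>.
\<close>

lemma induced_mult:
  assumes Q: "monoid_algebra_ideal m e N" and Q': "monoid_algebra_ideal m' e' N'"
    and pres: "preserves N N' f"
    and basis: "\<And>i j. residue_class N' (f (m i j)) = residue_class N' (convolution m' (g i) (h j))"
  shows "induced N' f (monoid_algebra_ideal.mult m N S T) =
    monoid_algebra_ideal.mult m' N' (induced N' g S) (induced N' h T)"
proof -
  interpret Q: monoid_algebra_ideal m e N by fact
  interpret Q': monoid_algebra_ideal m' e' N' by fact
  let ?ext = "linear_extension free_scale"
  let ?s = "representative S" and ?t = "representative T"
  have "induced N' f (Q.mult S T) = residue_class N' (?ext f (convolution m ?s ?t))"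
    unfolding Q.mult_def by (rule induced_residue_class[OF Q.N_subspace Q'.N_subspace pres])
  also have "\<dots> = residue_class N' (?ext (\<lambda>i. ?ext (\<lambda>j. f (m i j)) ?t) ?s)"
    by (simp add: linear_extension_convolution[OF module_free_scale])
  also have "\<dots> = residue_class N' (?ext (\<lambda>i. ?ext (\<lambda>j. convolution m' (g i) (h j)) ?t) ?s)"
    by (intro residue_class_cong_linear_extension Q'.N_subspace basis)
  also have "?ext (\<lambda>i. ?ext (\<lambda>j. convolution m' (g i) (h j)) ?t) ?s =
      convolution m' (?ext g ?s) (?ext h ?t)"
    by (simp add: module_hom_linear_extension[OF convolution_hom_left]
        module_hom_linear_extension[OF convolution_hom_right]
        linear_extension_swap[OF module_free_scale, of _ ?t])
  finally show ?thesis
    by (simp add: induced_def Q'.mult_residue_class)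
qed


section \<open>The tensor square and the tensor cube as monoids\<close>

context algebra_over
begin

lemma relations2_subspace: "free_subspace relations2"
  unfolding relations2_def by (rule module.subspace_span[OF module_free_scale])

lemma relations3_subspace: "free_subspace relations3"
  unfolding relations3_def by (rule module.subspace_span[OF module_free_scale])

lemma relations2_generators:
  "basis (a + a', b) - basis (a, b) - basis (a', b) \<in> relations2"
  "basis (a, b + b') - basis (a, b) - basis (a, b') \<in> relations2"
  "basis (scale r a, b) - free_scale r (basis (a, b)) \<in> relations2"
  "basis (a, scale r b) - free_scale r (basis (a, b)) \<in> relations2"
  unfolding relations2_def by (intro module.span_base[OF module_free_scale]; simp; (metis | fastforce))+

lemma relations3_generators:
  "basis (a + a', b, c) - basis (a, b, c) - basis (a', b, c) \<in> relations3"
  "basis (a, b + b', c) - basis (a, b, c) - basis (a, b', c) \<in> relations3"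
  "basis (a, b, c + c') - basis (a, b, c) - basis (a, b, c') \<in> relations3"
  "basis (scale r a, b, c) - free_scale r (basis (a, b, c)) \<in> relations3"
  "basis (a, scale r b, c) - free_scale r (basis (a, b, c)) \<in> relations3"
  "basis (a, b, scale r c) - free_scale r (basis (a, b, c)) \<in> relations3"
  unfolding relations3_def by (intro module.span_base[OF module_free_scale]; simp; (metis | fastforce))+

text \<open>
  The universal property of the tensor square, relative to a submodule \<open>N\<close> of the target. With
  \<open>N = {0}\<close> this is about maps into a module; with \<open>N\<close> the relations of another tensor power it
  yields maps between tensor powers, whose elements are cosets rather than members of a module type.
\<close>

lemma relations2_linear_extension:
  assumes s: "module s" and N: "module.subspace s N"
    and h: "\<And>a a' b. h (a + a', b) - h (a, b) - h (a', b) \<in> N"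
      "\<And>a b b'. h (a, b + b') - h (a, b) - h (a, b') \<in> N"
      "\<And>r a b. h (scale r a, b) - s r (h (a, b)) \<in> N"
      "\<And>r a b. h (a, scale r b) - s r (h (a, b)) \<in> N"
    and x: "x \<in> relations2"
  shows "linear_extension s h x \<in> N"
proof -
  interpret free: module free_scale by (rule module_free_scale)
  interpret s: module s by (rule s)
  from x show ?thesis
    unfolding relations2_def
  proof (rule free.span_induct)
    show "free.subspace {x. linear_extension s h x \<in> N}"
      using N linear_extension_hom[OF s, of h, THEN module_hom.zero]
      by (auto simp: free.subspace_def linear_extension_add[OF s] linear_extension_scale[OF s]
          s.subspace_def)
  qed (use h in \<open>auto simp: linear_extension_diff[OF s] linear_extension_scale[OF s]
        linear_extension_basis[OF s]\<close>)
qed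

lemma relations3_linear_extension:
  assumes s: "module s" and N: "module.subspace s N"
    and h: "\<And>a a' b c. h (a + a', b, c) - h (a, b, c) - h (a', b, c) \<in> N"
      "\<And>a b b' c. h (a, b + b', c) - h (a, b, c) - h (a, b', c) \<in> N"
      "\<And>a b c c'. h (a, b, c + c') - h (a, b, c) - h (a, b, c') \<in> N"
      "\<And>r a b c. h (scale r a, b, c) - s r (h (a, b, c)) \<in> N"
      "\<And>r a b c. h (a, scale r b, c) - s r (h (a, b, c)) \<in> N"
      "\<And>r a b c. h (a, b, scale r c) - s r (h (a, b, c)) \<in> N"
    and x: "x \<in> relations3"
  shows "linear_extension s h x \<in> N"
proof -
  interpret free: module free_scale by (rule module_free_scale)
  interpret s: module s by (rule s)
  from x show ?thesis
    unfolding relations3_def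
  proof (rule free.span_induct)
    show "free.subspace {x. linear_extension s h x \<in> N}"
      using N linear_extension_hom[OF s, of h, THEN module_hom.zero]
      by (auto simp: free.subspace_def linear_extension_add[OF s] linear_extension_scale[OF s]
          s.subspace_def)
  qed (use h in \<open>auto simp: linear_extension_diff[OF s] linear_extension_scale[OF s]
        linear_extension_basis[OF s]\<close>)
qed

lemma preserves_relations2:
  assumes "free_subspace N"
    and "\<And>a a' b. h (a + a', b) - h (a, b) - h (a', b) \<in> N"
      "\<And>a b b'. h (a, b + b') - h (a, b) - h (a, b') \<in> N"
      "\<And>r a b. h (scale r a, b) - free_scale r (h (a, b)) \<in> N"
      "\<And>r a b. h (a, scale r b) - free_scale r (h (a, b)) \<in> N"
  shows "preserves relations2 N h"
  unfolding preserves_def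
  using assms by (auto intro!: relations2_linear_extension[OF module_free_scale])

lemma preserves_relations3:
  assumes "free_subspace N"
    and "\<And>a a' b c. h (a + a', b, c) - h (a, b, c) - h (a', b, c) \<in> N"
      "\<And>a b b' c. h (a, b + b', c) - h (a, b, c) - h (a, b', c) \<in> N"
      "\<And>a b c c'. h (a, b, c + c') - h (a, b, c) - h (a, b, c') \<in> N"
      "\<And>r a b c. h (scale r a, b, c) - free_scale r (h (a, b, c)) \<in> N"
      "\<And>r a b c. h (a, scale r b, c) - free_scale r (h (a, b, c)) \<in> N"
      "\<And>r a b c. h (a, b, scale r c) - free_scale r (h (a, b, c)) \<in> N"
  shows "preserves relations3 N h"
  unfolding preserves_def
  using assms by (auto intro!: relations3_linear_extension[OF module_free_scale])

sublocale square: monoid_algebra_ideal "\<lambda>(a, b) (c, d). (a * c, b * d)" "(1, 1)" relations2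
proof
  let ?m = "\<lambda>(a, b) (c, d). (a * c :: 'a, b * d :: 'a)"
  show "free_subspace relations2" by (rule relations2_subspace)
  show "convolution ?m (basis i) x \<in> relations2" if "x \<in> relations2" for x and i :: "'a \<times> 'a"
    using that relations2_generators unfolding convolution_def free_simps
    by (intro relations2_linear_extension[OF module_free_scale relations2_subspace])
      (auto simp: distrib_left scale_mult_right split: prod.splits)
  show "convolution ?m x (basis i) \<in> relations2" if "x \<in> relations2" for x and i :: "'a \<times> 'a"
    using that relations2_generators unfolding convolution_eq_swap free_simps
    by (intro relations2_linear_extension[OF module_free_scale relations2_subspace])
      (auto simp: distrib_right scale_mult_left split: prod.splits)
qed (auto simp: mult.assoc)

sublocale cube: monoid_algebra_ideal
  "\<lambda>(a, b, c) (a', b', c'). (a * a', b * b', c * c')" "(1, 1, 1)" relations3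
proof
  let ?m = "\<lambda>(a, b, c) (a', b', c'). (a * a' :: 'a, b * b' :: 'a, c * c' :: 'a)"
  show "free_subspace relations3" by (rule relations3_subspace)
  show "convolution ?m (basis i) x \<in> relations3" if "x \<in> relations3" for x and i :: "'a \<times> 'a \<times> 'a"
    using that relations3_generators unfolding convolution_def free_simps
    by (intro relations3_linear_extension[OF module_free_scale relations3_subspace])
      (auto simp: distrib_left scale_mult_right split: prod.splits)
  show "convolution ?m x (basis i) \<in> relations3" if "x \<in> relations3" for x and i :: "'a \<times> 'a \<times> 'a"
    using that relations3_generators unfolding convolution_eq_swap free_simps
    by (intro relations3_linear_extension[OF module_free_scale relations3_subspace])
      (auto simp: distrib_right scale_mult_left split: prod.splits)
qed (auto simp: mult.assoc)

definition tensor_cube :: "('a \<times> 'a \<times> 'a \<Rightarrow>\<^sub>0 'k) set set"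
  where "tensor_cube = range tensor3"

definition one3 :: "('a \<times> 'a \<times> 'a \<Rightarrow>\<^sub>0 'k) set"
  where "one3 = tensor3 (basis (1, 1, 1))"

lemma tensor2_eq: "tensor2 = residue_class relations2"
  by (simp add: fun_eq_iff tensor2_def residue_class_def)

lemma tensor3_eq: "tensor3 = residue_class relations3"
  by (simp add: fun_eq_iff tensor3_def residue_class_def)

lemma mult2_eq: "mult2 = square.mult"
  by (simp add: fun_eq_iff mult2_def square.mult_def tensor2_eq sweedler_def convolution_def)
    (simp add: case_prod_unfold)

lemma mult3_eq: "mult3 = cube.mult"
  by (simp add: fun_eq_iff mult3_def cube.mult_def tensor3_eq sweedler3_def convolution_def)
    (simp add: case_prod_unfold)

lemma add2_eq: "add2 = class_add relations2"
  by (simp add: fun_eq_iff add2_def class_add_def tensor2_eq)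

lemma scale2_eq: "scale2 = class_scale relations2"
  by (simp add: fun_eq_iff scale2_def class_scale_def tensor2_eq)

lemma mult2_in [simp]: "mult2 S T \<in> tensor_square"
  unfolding mult2_def tensor_square_def by simp

lemma mult3_in [simp]: "mult3 S T \<in> tensor_cube"
  unfolding mult3_def tensor_cube_def by simp

lemma one2_in [simp]: "one2 \<in> tensor_square"
  unfolding one2_def tensor_square_def by simp

lemma one3_in [simp]: "one3 \<in> tensor_cube"
  unfolding one3_def tensor_cube_def by simp

lemma mult2_assoc: "mult2 (mult2 S T) U = mult2 S (mult2 T U)"
  by (simp add: mult2_eq square.mult_assoc)

lemma mult3_assoc: "mult3 (mult3 S T) U = mult3 S (mult3 T U)"
  by (simp add: mult3_eq cube.mult_assoc)

lemma mult2_one [simp]: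
  assumes "T \<in> tensor_square"
  shows "mult2 one2 T = T" "mult2 T one2 = T"
  using assms square.mult_one_left square.mult_one_right
  by (simp_all add: mult2_eq one2_def tensor2_eq tensor_square_def)

lemma mult3_one [simp]:
  assumes "T \<in> tensor_cube"
  shows "mult3 one3 T = T" "mult3 T one3 = T"
  using assms cube.mult_one_left cube.mult_one_right
  by (simp_all add: mult3_eq one3_def tensor3_eq tensor_cube_def)

lemma mult2_cancel:
  assumes "mult2 S T = one2" "U \<in> tensor_square"
  shows "mult2 S (mult2 T U) = U"
  using assms by (simp flip: mult2_assoc)

lemma mult3_cancel:
  assumes "mult3 S T = one3" "U \<in> tensor_cube"
  shows "mult3 S (mult3 T U) = U"
  using assms by (simp flip: mult3_assoc)

lemma is_inverse2_unique:
  assumes "is_inverse2 S T" "is_inverse2 S T'"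
  shows "T = T'"
proof -
  have "T = mult2 T (mult2 S T')"
    using assms by (simp add: is_inverse2_def)
  also have "\<dots> = T'"
    by (rule mult2_cancel) (use assms in \<open>simp_all add: is_inverse2_def\<close>)
  finally show ?thesis .
qed

lemma inverse2_eqI: "is_inverse2 S T \<Longrightarrow> inverse2 S = T"
  unfolding inverse2_def by (rule the_equality) (auto dest: is_inverse2_unique)

lemma inverse2:
  assumes "invertible2 S"
  shows "S \<in> tensor_square" "inverse2 S \<in> tensor_square"
    "mult2 S (inverse2 S) = one2" "mult2 (inverse2 S) S = one2"
  using assms inverse2_eqI by (auto simp: invertible2_def is_inverse2_def)


section \<open>Linear maps between the tensor powers\<close>

text \<open>
  The two adjacent transpositions generate all permutations of the three tensor factors; the
  cyclic ones occur below as their composites.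
\<close>

definition swap12 :: "('a \<times> 'a \<times> 'a \<Rightarrow>\<^sub>0 'k) set \<Rightarrow> ('a \<times> 'a \<times> 'a \<Rightarrow>\<^sub>0 'k) set"
  where "swap12 = induced relations3 (\<lambda>(a, b, c). basis (b, a, c))"

definition swap23 :: "('a \<times> 'a \<times> 'a \<Rightarrow>\<^sub>0 'k) set \<Rightarrow> ('a \<times> 'a \<times> 'a \<Rightarrow>\<^sub>0 'k) set"
  where "swap23 = induced relations3 (\<lambda>(a, b, c). basis (a, c, b))"

text \<open>
  The map \<open>T \<mapsto> T \<otimes> c\<close>. It splits \<open>(D \<otimes> id)(a \<otimes> b) = D a \<otimes> b\<close> into operations whose behaviour
  under multiplication is known.
\<close>

definition with_third :: "'a \<Rightarrow> ('a \<times> 'a \<Rightarrow>\<^sub>0 'k) set \<Rightarrow> ('a \<times> 'a \<times> 'a \<Rightarrow>\<^sub>0 'k) set"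
  where "with_third c = induced relations3 (\<lambda>(a, b). basis (a, b, c))"

lemma flip_eq: "flip = induced relations2 (\<lambda>(a, b). basis (b, a))"
  by (simp add: fun_eq_iff flip_def induced_def tensor2_eq sweedler_def)

lemma leg12_eq: "leg12 = induced relations3 (\<lambda>(a, b). basis (a, b, 1))"
  by (simp add: fun_eq_iff leg12_def induced_def tensor3_eq sweedler_def)

lemma leg13_eq: "leg13 = induced relations3 (\<lambda>(a, b). basis (a, 1, b))"
  by (simp add: fun_eq_iff leg13_def induced_def tensor3_eq sweedler_def)

lemma leg23_eq: "leg23 = induced relations3 (\<lambda>(a, b). basis (1, a, b))"
  by (simp add: fun_eq_iff leg23_def induced_def tensor3_eq sweedler_def)

lemma leg12_with_third: "leg12 = with_third 1"
  by (simp add: leg12_eq with_third_def)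

lemma map_left_eq: "map_left D = induced relations3
    (\<lambda>(a, b). linear_extension free_scale (\<lambda>(c, d). basis (c, d, b)) (representative (D a)))"
  by (simp add: fun_eq_iff map_left_def induced_def tensor3_eq sweedler_def)

lemma map_right_eq: "map_right D = induced relations3
    (\<lambda>(a, b). linear_extension free_scale (\<lambda>(c, d). basis (a, c, d)) (representative (D b)))"
  by (simp add: fun_eq_iff map_right_def induced_def tensor3_eq sweedler_def)

lemmas map_eqs = flip_eq swap12_def swap23_def with_third_def leg12_eq leg13_eq leg23_eq
  map_left_eq map_right_eq

lemma induced_in2 [simp]: "induced relations2 f T \<in> tensor_square"
  by (simp add: induced_def tensor_square_def tensor2_eq)

lemma induced_in3 [simp]: "induced relations3 f T \<in> tensor_cube"
  by (simp add: induced_def tensor_cube_def tensor3_eq)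

lemma map_in [simp]:
  "flip T \<in> tensor_square" "swap12 U \<in> tensor_cube" "swap23 U \<in> tensor_cube"
  "with_third c T \<in> tensor_cube"
  "leg12 T \<in> tensor_cube" "leg13 T \<in> tensor_cube" "leg23 T \<in> tensor_cube"
  "map_left D T \<in> tensor_cube" "map_right D T \<in> tensor_cube"
  by (simp_all add: map_eqs)

lemma preserves_flip: "preserves relations2 relations2 (\<lambda>(a, b). basis (b, a))"
  by (rule preserves_relations2) (auto simp: relations2_subspace relations2_generators)

lemma preserves_swap12: "preserves relations3 relations3 (\<lambda>(a, b, c). basis (b, a, c))"
  by (rule preserves_relations3) (auto simp: relations3_subspace relations3_generators)

lemma preserves_swap23: "preserves relations3 relations3 (\<lambda>(a, b, c). basis (a, c, b))"
  by (rule preserves_relations3) (auto simp: relations3_subspace relations3_generators)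

lemma preserves_with_third: "preserves relations2 relations3 (\<lambda>(a, b). basis (a, b, c))"
  by (rule preserves_relations2) (auto simp: relations3_subspace relations3_generators)

lemma preserves_leg13: "preserves relations2 relations3 (\<lambda>(a, b). basis (a, c, b))"
  by (rule preserves_relations2) (auto simp: relations3_subspace relations3_generators)

lemma preserves_leg23: "preserves relations2 relations3 (\<lambda>(a, b). basis (c, a, b))"
  by (rule preserves_relations2) (auto simp: relations3_subspace relations3_generators)

lemma flip_mult: "flip (mult2 S T) = mult2 (flip S) (flip T)"
  unfolding flip_eq mult2_eq
  by (rule induced_mult[OF square.monoid_algebra_ideal_axioms square.monoid_algebra_ideal_axioms
        preserves_flip]) (auto simp: convolution_basis)

lemma swap12_mult: "swap12 (mult3 S T) = mult3 (swap12 S) (swap12 T)"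
  unfolding swap12_def mult3_eq
  by (rule induced_mult[OF cube.monoid_algebra_ideal_axioms cube.monoid_algebra_ideal_axioms
        preserves_swap12]) (auto simp: convolution_basis)

lemma swap23_mult: "swap23 (mult3 S T) = mult3 (swap23 S) (swap23 T)"
  unfolding swap23_def mult3_eq
  by (rule induced_mult[OF cube.monoid_algebra_ideal_axioms cube.monoid_algebra_ideal_axioms
        preserves_swap23]) (auto simp: convolution_basis)

lemma with_third_mult: "with_third (c * d) (mult2 S T) = mult3 (with_third c S) (with_third d T)"
  unfolding with_third_def mult2_eq mult3_eq
  by (rule induced_mult[OF square.monoid_algebra_ideal_axioms cube.monoid_algebra_ideal_axioms
        preserves_with_third]) (auto simp: convolution_basis)

lemma leg12_mult: "leg12 (mult2 S T) = mult3 (leg12 S) (leg12 T)"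
  using with_third_mult[of 1 1] by (simp add: leg12_with_third)

lemma leg13_mult: "leg13 (mult2 S T) = mult3 (leg13 S) (leg13 T)"
  unfolding leg13_eq mult2_eq mult3_eq
  by (rule induced_mult[OF square.monoid_algebra_ideal_axioms cube.monoid_algebra_ideal_axioms
        preserves_leg13]) (auto simp: convolution_basis)

lemma leg23_mult: "leg23 (mult2 S T) = mult3 (leg23 S) (leg23 T)"
  unfolding leg23_eq mult2_eq mult3_eq
  by (rule induced_mult[OF square.monoid_algebra_ideal_axioms cube.monoid_algebra_ideal_axioms
        preserves_leg23]) (auto simp: convolution_basis)

lemma flip_one: "flip one2 = one2"
  by (simp add: flip_eq one2_def tensor2_eq free_simps
      induced_residue_class[OF relations2_subspace relations2_subspace preserves_flip])

lemma leg_one: "leg12 one2 = one3" "leg13 one2 = one3" "leg23 one2 = one3"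
  by (simp_all add: leg12_eq leg13_eq leg23_eq one2_def one3_def tensor2_eq tensor3_eq free_simps
      induced_residue_class[OF relations2_subspace relations3_subspace] preserves_with_third
      preserves_leg13 preserves_leg23)

lemmas induced_comp2 = induced_induced[OF relations2_subspace relations2_subspace preserves_flip]
  induced_induced[OF relations2_subspace relations3_subspace preserves_with_third]
  induced_induced[OF relations2_subspace relations3_subspace preserves_leg13]
  induced_induced[OF relations2_subspace relations3_subspace preserves_leg23]
  induced_induced[OF relations3_subspace relations3_subspace preserves_swap12]
  induced_induced[OF relations3_subspace relations3_subspace preserves_swap23]

lemma induced_basis2: "T \<in> tensor_square \<Longrightarrow> induced relations2 (\<lambda>(a, b). basis (a, b)) T = T"
  by (simp add: case_prod_unfold induced_def free_expansion tensor_square_def tensor2_eq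
      residue_class_representative relations2_subspace)

lemma induced_basis3: "T \<in> tensor_cube \<Longrightarrow> induced relations3 (\<lambda>(a, b, c). basis (a, b, c)) T = T"
  by (simp add: case_prod_unfold induced_def free_expansion tensor_cube_def tensor3_eq
      residue_class_representative relations3_subspace)

lemma flip_flip: "T \<in> tensor_square \<Longrightarrow> flip (flip T) = T"
  unfolding flip_eq induced_comp2
  using induced_basis2 by (simp add: free_simps case_prod_unfold)

lemma swap_swap:
  assumes "T \<in> tensor_cube"
  shows "swap12 (swap12 T) = T" "swap23 (swap23 T) = T"
  unfolding swap12_def swap23_def induced_comp2
  using induced_basis3[OF assms] by (simp_all add: free_simps case_prod_unfold)

lemma swap_leg:
  "swap12 (leg12 T) = leg12 (flip T)" "swap12 (leg13 T) = leg23 T" "swap12 (leg23 T) = leg13 T"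
  "swap23 (leg12 T) = leg13 T" "swap23 (leg13 T) = leg12 T" "swap23 (leg23 T) = leg23 (flip T)"
  unfolding map_eqs induced_comp2
  by (simp_all add: free_simps case_prod_unfold)


section \<open>Applying a coproduct to one tensor factor\<close>

text \<open>
  \<open>D\<close> is linear as a map into the tensor square; this is what makes \<open>D \<otimes> id\<close> and \<open>id \<otimes> D\<close>
  well defined. Besides \<open>\<Delta>\<close> it applies to the opposite and to the twisted coproduct.
\<close>

definition linear2 :: "('a \<Rightarrow> ('a \<times> 'a \<Rightarrow>\<^sub>0 'k) set) \<Rightarrow> bool"
  where "linear2 D \<longleftrightarrow> (\<forall>x. D x \<in> tensor_square) \<and>
    (\<forall>x y. D (x + y) = add2 (D x) (D y)) \<and> (\<forall>c x. D (scale c x) = scale2 c (D x))"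

lemma linear2_flip:
  assumes "linear2 D"
  shows "linear2 (\<lambda>x. flip (D x))"
  using assms
  by (simp add: linear2_def add2_eq scale2_eq flip_eq
      induced_class_add[OF relations2_subspace relations2_subspace preserves_flip]
      induced_class_scale[OF relations2_subspace relations2_subspace preserves_flip])

lemma linear2_mult:
  assumes "linear2 D"
  shows "linear2 (\<lambda>x. mult2 (mult2 S (D x)) T)"
  using assms
  by (simp add: linear2_def add2_eq scale2_eq mult2_eq square.mult_class_add_left
      square.mult_class_add_right square.mult_class_scale_left square.mult_class_scale_right
      mult2_in[unfolded mult2_eq])

text \<open>
  Linearity in the first factor comes from linearity of \<open>D\<close>: the representatives of \<open>D (a + a')\<close>
  and of \<open>D a\<close> and \<open>D a'\<close> match up to a relation, which \<open>T \<mapsto> T \<otimes> b\<close> preserves. Linearity in the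
  second factor holds termwise.
\<close>

lemma preserves_map_left:
  assumes "linear2 D"
  shows "preserves relations2 relations3 (\<lambda>(a, b).
    linear_extension free_scale (\<lambda>(c, d). basis (c, d, b)) (representative (D a)))"
proof -
  interpret free: module free_scale by (rule module_free_scale)
  let ?g = "\<lambda>b (c, d). basis (c, d, b) :: 'a \<times> 'a \<times> 'a \<Rightarrow>\<^sub>0 'k"
  let ?r = "\<lambda>a. representative (D a)"
  have D: "D a = residue_class relations2 (?r a)" for a
    using assms
    by (simp add: linear2_def tensor_square_def tensor2_eq residue_class_representative
        relations2_subspace)
  have add: "?r (a + a') - ?r a - ?r a' \<in> relations2" for a a'
  proof -
    have "residue_class relations2 (?r (a + a')) = add2 (D a) (D a')"
      using assms unfolding D[symmetric] by (simp add: linear2_def)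
    also have "\<dots> = residue_class relations2 (?r a + ?r a')"
      by (simp add: add2_def tensor2_eq)
    finally have "residue_class relations2 (?r (a + a')) = residue_class relations2 (?r a + ?r a')" .
    then show ?thesis by (simp add: residue_class_eq_iff relations2_subspace diff_diff_eq)
  qed
  have scl: "?r (scale c a) - free_scale c (?r a) \<in> relations2" for c a
  proof -
    have "residue_class relations2 (?r (scale c a)) = scale2 c (D a)"
      using assms unfolding D[symmetric] by (simp add: linear2_def)
    also have "\<dots> = residue_class relations2 (free_scale c (?r a))"
      by (simp add: scale2_def tensor2_eq)
    finally have "residue_class relations2 (?r (scale c a)) = residue_class relations2 (free_scale c (?r a))" .
    then show ?thesis by (simp add: residue_class_eq_iff relations2_subspace)
  qed
  have pres: "linear_extension free_scale (?g b) x \<in> relations3" if "x \<in> relations2" for x b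
    using preserves_with_third that by (auto simp: preserves_def)
  show ?thesis
  proof (rule preserves_relations2[OF relations3_subspace]; unfold prod.case)
    show "linear_extension free_scale (?g b) (?r (a + a')) - linear_extension free_scale (?g b) (?r a)
        - linear_extension free_scale (?g b) (?r a') \<in> relations3" for a a' b
      using pres[OF add] by (simp add: free_simps)
    show "linear_extension free_scale (?g b) (?r (scale r a))
        - free_scale r (linear_extension free_scale (?g b) (?r a)) \<in> relations3" for r a b
      using pres[OF scl] by (simp add: free_simps)
    show "linear_extension free_scale (?g (b + b')) (?r a) - linear_extension free_scale (?g b) (?r a)
        - linear_extension free_scale (?g b') (?r a) \<in> relations3" for a b b'
      unfolding linear_extension_diff_fun[OF module_free_scale, symmetric]
      by (rule linear_extension_mem[OF module_free_scale relations3_subspace])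
        (auto simp: relations3_generators)
    show "linear_extension free_scale (?g (scale r b)) (?r a)
        - free_scale r (linear_extension free_scale (?g b) (?r a)) \<in> relations3" for r a b
      unfolding linear_extension_diff_fun[OF module_free_scale, symmetric]
        linear_extension_scale_fun[OF module_free_scale, symmetric]
      by (rule linear_extension_mem[OF module_free_scale relations3_subspace])
        (auto simp: relations3_generators)
  qed
qed

lemma map_left_mult:
  assumes "linear2 D" and "\<And>x y. D (x * y) = mult2 (D x) (D y)"
  shows "map_left D (mult2 S T) = mult3 (map_left D S) (map_left D T)"
  unfolding map_left_eq mult2_eq mult3_eq
proof (rule induced_mult[OF square.monoid_algebra_ideal_axioms cube.monoid_algebra_ideal_axioms
        preserves_map_left[OF assms(1)]])
  fix i j :: "'a \<times> 'a"
  obtain a b c d where [simp]: "i = (a, b)" "j = (c, d)" by (cases i, cases j)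
  have "with_third (b * d) (D (a * c)) = mult3 (with_third b (D a)) (with_third d (D c))"
    by (simp add: assms(2) with_third_mult)
  then show "residue_class relations3 (case (\<lambda>(a, b) (c, d). (a * c, b * d)) i j of (a, b) \<Rightarrow>
        linear_extension free_scale (\<lambda>(c, d). basis (c, d, b)) (representative (D a))) =
      residue_class relations3 (convolution (\<lambda>(a, b, c) (a', b', c'). (a * a', b * b', c * c'))
        (case i of (a, b) \<Rightarrow>
           linear_extension free_scale (\<lambda>(c, d). basis (c, d, b)) (representative (D a)))
        (case j of (a, b) \<Rightarrow>
           linear_extension free_scale (\<lambda>(c, d). basis (c, d, b)) (representative (D a))))"
    by (simp add: with_third_def induced_def mult3_eq cube.mult_residue_class)
qed

text \<open>
  On a pure tensor \<open>a \<otimes> b\<close> both sides are \<open>D' a Y \<otimes> b = Y' D a \<otimes> b\<close>. With \<open>Y = Y' = F\<close> this compares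
  the twisted coproduct with \<open>\<Delta>\<close>, and with \<open>Y = Y' = R\<close> the opposite coproduct with \<open>\<Delta>\<close>.
\<close>

lemma map_left_intertwine:
  assumes "\<And>a. mult2 (D' a) Y = mult2 Y' (D a)"
  shows "mult3 (map_left D' T) (leg12 Y) = mult3 (leg12 Y') (map_left D T)"
proof -
  let ?ext = "linear_extension free_scale" and ?g = "\<lambda>b (c, d). basis (c, d, b) :: 'a \<times> 'a \<times> 'a \<Rightarrow>\<^sub>0 'k"
  let ?k = "\<lambda>D (a, b). ?ext (?g b) (representative (D a))"
  let ?conv = "convolution (\<lambda>(a, b, c) (a', b', c'). (a * a', b * b', c * c'))"
  let ?y = "?ext (?g 1) (representative Y)" and ?y' = "?ext (?g 1) (representative Y')"
  have "mult3 (with_third b (D' a)) (leg12 Y) = mult3 (leg12 Y') (with_third b (D a))" for a b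
    using assms[of a] with_third_mult[of b 1 "D' a" Y] with_third_mult[of 1 b Y' "D a"]
    by (simp add: leg12_with_third)
  then have "residue_class relations3 (?conv (?ext (?g b) (representative (D' a))) ?y) =
      residue_class relations3 (?conv ?y' (?ext (?g b) (representative (D a))))" for a b
    by (simp add: with_third_def leg12_with_third induced_def mult3_eq cube.mult_residue_class)
  then have "residue_class relations3 (?ext (\<lambda>i. ?conv (?k D' i) ?y) (representative T)) =
      residue_class relations3 (?ext (\<lambda>i. ?conv ?y' (?k D i)) (representative T))"
    by (intro residue_class_cong_linear_extension relations3_subspace) auto
  then show ?thesis
    unfolding map_left_eq leg12_eq induced_def mult3_eq cube.mult_residue_class
      module_hom_linear_extension[OF convolution_hom_left, where h = "?k D'"]
      module_hom_linear_extension[OF convolution_hom_right, where h = "?k D"] .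
qed

lemma map_left_one:
  assumes "linear2 D" "D 1 = one2"
  shows "map_left D one2 = one3"
proof -
  have "map_left D one2 = with_third 1 (D 1)"
    by (simp add: map_left_eq one2_def tensor2_eq free_simps with_third_def
        induced_residue_class[OF relations2_subspace relations3_subspace preserves_map_left[OF assms(1)]])
      (simp add: induced_def)
  then show ?thesis
    by (simp add: assms(2) leg_one flip: leg12_with_third)
qed

lemma swap12_map_left: "swap12 (map_left D T) = map_left (\<lambda>x. flip (D x)) T"
  unfolding swap12_def map_left_eq
    induced_induced[OF relations3_subspace relations3_subspace preserves_swap12]
proof (rule induced_cong[OF relations3_subspace])
  fix i :: "'a \<times> 'a"
  obtain a b where [simp]: "i = (a, b)" by (cases i)
  have "swap12 (with_third b (D a)) = with_third b (flip (D a))"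
    unfolding map_eqs induced_comp2 by (simp add: free_simps case_prod_unfold)
  then show "residue_class relations3 (linear_extension free_scale (\<lambda>(a, b, c). basis (b, a, c))
        (case i of (a, b) \<Rightarrow>
           linear_extension free_scale (\<lambda>(c, d). basis (c, d, b)) (representative (D a)))) =
      residue_class relations3 (case i of (a, b) \<Rightarrow>
        linear_extension free_scale (\<lambda>(c, d). basis (c, d, b)) (representative (flip (D a))))"
    unfolding with_third_def induced_def[of _ _ "D a"] swap12_def
    by (simp add: induced_residue_class[OF relations3_subspace relations3_subspace preserves_swap12])
      (simp add: induced_def)
qed

text \<open>
  Everything about \<open>id \<otimes> D\<close> follows from \<open>D \<otimes> id\<close> by flipping the argument and rotating the result:
  \<open>b \<otimes> a\<close> goes to \<open>b\<^sub>1 \<otimes> b\<^sub>2 \<otimes> a\<close> and then to \<open>a \<otimes> b\<^sub>1 \<otimes> b\<^sub>2\<close>.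
\<close>

lemma map_right_map_left:
  assumes "linear2 D"
  shows "map_right D T = swap12 (swap23 (map_left D (flip T)))"
  unfolding flip_eq swap12_def swap23_def map_left_eq map_right_eq induced_comp2
    induced_induced[OF relations2_subspace relations3_subspace preserves_map_left[OF assms]]
  by (simp add: free_simps linear_extension_comp[OF module_free_scale] case_prod_unfold)

lemma map_left_map_right:
  assumes "linear2 D" "T \<in> tensor_square"
  shows "map_left D T = swap23 (swap12 (map_right D (flip T)))"
  by (simp add: map_right_map_left[OF assms(1)] flip_flip[OF assms(2)] swap_swap)

lemma braid: "swap12 (swap23 (swap12 T)) = swap23 (swap12 (swap23 T))"
  unfolding swap12_def swap23_def induced_comp2 by (simp add: free_simps case_prod_unfold)

lemma swap23_map_right:
  assumes "linear2 D"
  shows "swap23 (map_right D T) = map_right (\<lambda>x. flip (D x)) T"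
  by (simp add: map_right_map_left[OF assms] map_right_map_left[OF linear2_flip[OF assms]] braid
      flip: swap12_map_left)

lemma map_right_mult:
  assumes "linear2 D" and "\<And>x y. D (x * y) = mult2 (D x) (D y)"
  shows "map_right D (mult2 S T) = mult3 (map_right D S) (map_right D T)"
  by (simp add: map_right_map_left[OF assms(1)] flip_mult map_left_mult[OF assms] swap12_mult swap23_mult)

lemma map_right_one:
  assumes "linear2 D" "D 1 = one2"
  shows "map_right D one2 = one3"
proof -
  have "swap12 (swap23 one3) = one3"
    using swap_leg(2,5)[of one2] swap_leg(4)[of one2] by (simp add: leg_one)
  then show ?thesis
    by (simp add: map_right_map_left[OF assms(1)] flip_one map_left_one[OF assms])
qed

lemma map_right_intertwine:
  assumes "linear2 D" "linear2 D'" "\<And>a. mult2 (D' a) Y = mult2 Y' (D a)"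
  shows "mult3 (map_right D' T) (leg23 Y) = mult3 (leg23 Y') (map_right D T)"
proof -
  have "swap12 (swap23 (mult3 (map_left D' (flip T)) (leg12 Y))) =
      swap12 (swap23 (mult3 (leg12 Y') (map_left D (flip T))))"
    by (simp add: map_left_intertwine[OF assms(3)])
  then show ?thesis
    by (simp add: swap12_mult swap23_mult swap_leg map_right_map_left[OF assms(1)]
        map_right_map_left[OF assms(2)])
qed

end


section \<open>Multilinear maps on tensors\<close>

definition trilinear_map ::
    "('k::comm_ring_1 \<Rightarrow> 'a::ab_group_add \<Rightarrow> 'a) \<Rightarrow> ('k \<Rightarrow> 'c::ab_group_add \<Rightarrow> 'c) \<Rightarrow>
     ('a \<Rightarrow> 'a \<Rightarrow> 'a \<Rightarrow> 'c) \<Rightarrow> bool"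
  where "trilinear_map s t h \<longleftrightarrow>
    (\<forall>b c. module_hom s t (\<lambda>a. h a b c)) \<and> (\<forall>a c. module_hom s t (\<lambda>b. h a b c)) \<and>
    (\<forall>a b. module_hom s t (\<lambda>c. h a b c))"

lemma module_homI:
  assumes "module s" "module t" "\<And>x y. L (x + y) = L x + L y" "\<And>c x. L (s c x) = t c (L x)"
  shows "module_hom s t L"
  using assms by (simp add: module_hom_def module_hom_axioms_def)

lemma sweedler_hom:
  assumes "module_hom s t L"
  shows "L (sweedler s h T) = sweedler t (\<lambda>a b. L (h a b)) T"
  by (simp add: sweedler_def module_hom_linear_extension[OF assms] case_prod_unfold)

lemma sweedler_add_fun:
  assumes "module s"
  shows "sweedler s (\<lambda>a b. h a b + h' a b) T = sweedler s h T + sweedler s h' T"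
  by (simp add: sweedler_def case_prod_unfold linear_extension_add_fun[OF assms])

lemma sweedler_scale_fun:
  assumes "module s"
  shows "sweedler s (\<lambda>a b. s c (h a b)) T = s c (sweedler s h T)"
  by (simp add: sweedler_def case_prod_unfold linear_extension_scale_fun[OF assms])

lemma sweedler_uminus_fun:
  assumes "module s"
  shows "sweedler s (\<lambda>a b. - h a b) T = - sweedler s h T"
proof -
  interpret module s by fact
  show ?thesis
    using sweedler_scale_fun[OF assms, of "-1"] by simp
qed

lemma sweedler_swap:
  assumes "module s"
  shows "sweedler s (\<lambda>a b. sweedler s (\<lambda>c d. h a b c d) T) S =
    sweedler s (\<lambda>c d. sweedler s (\<lambda>a b. h a b c d) S) T"
  unfolding sweedler_def case_prod_unfold by (rule linear_extension_swap[OF assms])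

lemma sweedler3_add_fun:
  assumes "module s"
  shows "sweedler3 s (\<lambda>a b c. h a b c + h' a b c) T = sweedler3 s h T + sweedler3 s h' T"
  by (simp add: sweedler3_def case_prod_unfold linear_extension_add_fun[OF assms])

lemma sweedler3_scale_fun:
  assumes "module s"
  shows "sweedler3 s (\<lambda>a b c. s r (h a b c)) T = s r (sweedler3 s h T)"
  by (simp add: sweedler3_def case_prod_unfold linear_extension_scale_fun[OF assms])

lemma bilinear_mapI:
  assumes "module s1" "module s2" "module s3"
    and "\<And>a a' b. h (a + a') b = h a b + h a' b" "\<And>a b b'. h a (b + b') = h a b + h a b'"
    and "\<And>r a b. h (s1 r a) b = s3 r (h a b)" "\<And>r a b. h a (s2 r b) = s3 r (h a b)"
  shows "bilinear_map s1 s2 s3 h"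
  using assms by (auto simp: bilinear_map_def intro!: module_homI)

lemma bilinear_mapD:
  assumes "bilinear_map s1 s2 s3 h"
  shows "h (a + a') b = h a b + h a' b" "h a (b + b') = h a b + h a b'"
    "h (s1 r a) b = s3 r (h a b)" "h a (s2 r b) = s3 r (h a b)"
  using assms module_hom.add[of s1 s3 "\<lambda>a. h a b"] module_hom.add[of s2 s3 "h a"]
    module_hom.scale[of s1 s3 "\<lambda>a. h a b"] module_hom.scale[of s2 s3 "h a"]
  by (auto simp: bilinear_map_def)

lemma trilinear_mapI:
  assumes "module s" "module t"
    and "\<And>a a' b c. h (a + a') b c = h a b c + h a' b c"
      "\<And>a b b' c. h a (b + b') c = h a b c + h a b' c"
      "\<And>a b c c'. h a b (c + c') = h a b c + h a b c'"
    and "\<And>r a b c. h (s r a) b c = t r (h a b c)" "\<And>r a b c. h a (s r b) c = t r (h a b c)"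
      "\<And>r a b c. h a b (s r c) = t r (h a b c)"
  shows "trilinear_map s t h"
  using assms by (auto simp: trilinear_map_def intro!: module_homI)

lemma trilinear_mapD:
  assumes "trilinear_map s t h"
  shows "h (a + a') b c = h a b c + h a' b c" "h a (b + b') c = h a b c + h a b' c"
    "h a b (c + c') = h a b c + h a b c'"
    "h (s r a) b c = t r (h a b c)" "h a (s r b) c = t r (h a b c)"
    "h a b (s r c) = t r (h a b c)"
  using assms module_hom.add[of s t "\<lambda>a. h a b c"] module_hom.add[of s t "\<lambda>b. h a b c"]
    module_hom.add[of s t "\<lambda>c. h a b c"]
    module_hom.scale[of s t "\<lambda>a. h a b c"] module_hom.scale[of s t "\<lambda>b. h a b c"]
    module_hom.scale[of s t "\<lambda>c. h a b c"]
  by (auto simp: trilinear_map_def)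

context algebra_over
begin

lemma sweedler3_tensor3:
  assumes s: "module s" and h: "trilinear_map scale s h"
  shows "sweedler3 s h (tensor3 x) = linear_extension s (\<lambda>(a, b, c). h a b c) x"
proof -
  interpret s: module s by (rule s)
  let ?L = "linear_extension s (\<lambda>(a, b, c). h a b c)"
  have "?L (representative (residue_class relations3 x) - x) \<in> {0}"
    by (rule relations3_linear_extension[OF s s.subspace_single_0 _ _ _ _ _ _
          representative_residue_class[OF relations3_subspace]])
      (simp_all add: trilinear_mapD[OF h])
  then show ?thesis
    by (simp add: sweedler3_def tensor3_eq linear_extension_diff[OF s])
qed

text \<open>
  Needed to evaluate a sum over a tensor in the cube whose summand is itself such a sum.
\<close>

lemma trilinear_map_sweedler3:
  assumes s: "module s" and H: "\<And>x y z. trilinear_map scale s (\<lambda>a b c. H a b c x y z)"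
  shows "trilinear_map scale s (\<lambda>a b c. sweedler3 s (\<lambda>x y z. H a b c x y z) T)"
proof (rule trilinear_mapI[OF module_axioms s])
  note D = H[THEN trilinear_mapD(1)] H[THEN trilinear_mapD(2)] H[THEN trilinear_mapD(3)]
    H[THEN trilinear_mapD(4)] H[THEN trilinear_mapD(5)] H[THEN trilinear_mapD(6)]
  show "sweedler3 s (\<lambda>x y z. H (a + a') b c x y z) T =
      sweedler3 s (\<lambda>x y z. H a b c x y z) T + sweedler3 s (\<lambda>x y z. H a' b c x y z) T" for a a' b c
    by (subst D(1)) (rule sweedler3_add_fun[OF s])
  show "sweedler3 s (\<lambda>x y z. H a (b + b') c x y z) T =
      sweedler3 s (\<lambda>x y z. H a b c x y z) T + sweedler3 s (\<lambda>x y z. H a b' c x y z) T" for a b b' c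
    by (subst D(2)) (rule sweedler3_add_fun[OF s])
  show "sweedler3 s (\<lambda>x y z. H a b (c + c') x y z) T =
      sweedler3 s (\<lambda>x y z. H a b c x y z) T + sweedler3 s (\<lambda>x y z. H a b c' x y z) T" for a b c c'
    by (subst D(3)) (rule sweedler3_add_fun[OF s])
  show "sweedler3 s (\<lambda>x y z. H (scale r a) b c x y z) T =
      s r (sweedler3 s (\<lambda>x y z. H a b c x y z) T)" for r a b c
    by (subst D(4)) (rule sweedler3_scale_fun[OF s])
  show "sweedler3 s (\<lambda>x y z. H a (scale r b) c x y z) T =
      s r (sweedler3 s (\<lambda>x y z. H a b c x y z) T)" for r a b c
    by (subst D(5)) (rule sweedler3_scale_fun[OF s])
  show "sweedler3 s (\<lambda>x y z. H a b (scale r c) x y z) T =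
      s r (sweedler3 s (\<lambda>x y z. H a b c x y z) T)" for r a b c
    by (subst D(6)) (rule sweedler3_scale_fun[OF s])
qed

lemma sweedler_one2:
  assumes "module s" "bilinear_map scale scale s h"
  shows "sweedler s h one2 = h 1 1"
  by (simp add: one2_def sweedler_tensor2[OF assms] linear_extension_basis[OF assms(1)])

lemma sweedler_mult2:
  assumes "module s" "bilinear_map scale scale s h"
  shows "sweedler s h (mult2 S T) = sweedler s (\<lambda>a b. sweedler s (\<lambda>c d. h (a * c) (b * d)) T) S"
  by (simp add: mult2_def sweedler_tensor2[OF assms])
    (simp add: sweedler_def linear_extension_comp[OF assms(1)] linear_extension_basis[OF assms(1)]
      case_prod_unfold)

lemma sweedler_flip:
  assumes "module s" "bilinear_map scale scale s h"
  shows "sweedler s h (flip T) = sweedler s (\<lambda>a b. h b a) T"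
  by (simp add: flip_def sweedler_tensor2[OF assms])
    (simp add: sweedler_def linear_extension_comp[OF assms(1)] linear_extension_basis[OF assms(1)]
      case_prod_unfold)

lemma sweedler3_mult3:
  assumes "module s" "trilinear_map scale s h"
  shows "sweedler3 s h (mult3 S T) =
    sweedler3 s (\<lambda>a b c. sweedler3 s (\<lambda>a' b' c'. h (a * a') (b * b') (c * c')) T) S"
  by (simp add: mult3_def sweedler3_tensor3[OF assms])
    (simp add: sweedler3_def linear_extension_comp[OF assms(1)] linear_extension_basis[OF assms(1)]
      case_prod_unfold)

lemma sweedler3_leg12:
  assumes "module s" "trilinear_map scale s h"
  shows "sweedler3 s h (leg12 T) = sweedler s (\<lambda>a b. h a b 1) T"
  by (simp add: leg12_def sweedler3_tensor3[OF assms])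
    (simp add: sweedler_def linear_extension_comp[OF assms(1)] linear_extension_basis[OF assms(1)]
      case_prod_unfold)

lemma sweedler3_leg23:
  assumes "module s" "trilinear_map scale s h"
  shows "sweedler3 s h (leg23 T) = sweedler s (\<lambda>a b. h 1 a b) T"
  by (simp add: leg23_def sweedler3_tensor3[OF assms])
    (simp add: sweedler_def linear_extension_comp[OF assms(1)] linear_extension_basis[OF assms(1)]
      case_prod_unfold)

lemma sweedler3_swap12:
  assumes "module s" "trilinear_map scale s h"
  shows "sweedler3 s h (swap12 T) = sweedler3 s (\<lambda>a b c. h b a c) T"
  by (simp add: swap12_def induced_def sweedler3_tensor3[OF assms] flip: tensor3_eq)
    (simp add: sweedler3_def linear_extension_comp[OF assms(1)] linear_extension_basis[OF assms(1)]
      case_prod_unfold)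

lemma sweedler3_map_left:
  assumes "module s" "trilinear_map scale s h"
  shows "sweedler3 s h (map_left D T) = sweedler s (\<lambda>a b. sweedler s (\<lambda>c d. h c d b) (D a)) T"
  by (simp add: map_left_def sweedler3_tensor3[OF assms])
    (simp add: sweedler_def linear_extension_comp[OF assms(1)] linear_extension_basis[OF assms(1)]
      case_prod_unfold)

lemma sweedler3_map_right:
  assumes "module s" "trilinear_map scale s h"
  shows "sweedler3 s h (map_right D T) = sweedler s (\<lambda>a b. sweedler s (\<lambda>c d. h a c d) (D b)) T"
  by (simp add: map_right_def sweedler3_tensor3[OF assms])
    (simp add: sweedler_def linear_extension_comp[OF assms(1)] linear_extension_basis[OF assms(1)]
      case_prod_unfold)

lemma sweedler_mult_const:
  "c * sweedler scale h T = sweedler scale (\<lambda>a b. c * h a b) T"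
  "sweedler scale h T * c = sweedler scale (\<lambda>a b. h a b * c) T"
  by (rule sweedler_hom[of scale scale "\<lambda>x. c * x"] sweedler_hom[of scale scale "\<lambda>x. x * c"];
      rule module_homI; simp add: module_axioms algebra_simps scale_mult_left scale_mult_right)+

end


section \<open>The antipode reverses products\<close>

context bialgebra
begin

lemma comult_linear: "linear2 \<Delta>"
  by (simp add: linear2_def comult_in comult_add comult_scale)

lemma counit_add: "\<epsilon> (x + y) = \<epsilon> x + \<epsilon> y"
  by (rule module_hom.add[OF counit_linear])

lemma counit_scale: "\<epsilon> (scale c x) = c * \<epsilon> x"
  by (rule module_hom.scale[OF counit_linear])

lemmas multilinear_simps = distrib_left distrib_right scale_left_distrib scale_right_distrib
  scale_mult_left scale_mult_right counit_add counit_scale mult.commute[of "_ :: 'k"]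
  mult.left_commute[of "_ :: 'k"]

definition is_antipode :: "('a \<Rightarrow> 'a) \<Rightarrow> bool"
  where "is_antipode S \<longleftrightarrow> module_hom scale scale S \<and>
    (\<forall>x. sweedler scale (\<lambda>a b. S a * b) (\<Delta> x) = scale (\<epsilon> x) 1 \<and>
         sweedler scale (\<lambda>a b. a * S b) (\<Delta> x) = scale (\<epsilon> x) 1)"

lemma antipode_one:
  assumes "is_antipode S"
  shows "S 1 = 1"
proof -
  interpret S: module_hom scale scale S using assms by (simp add: is_antipode_def)
  have "bilinear_map scale scale scale (\<lambda>a b. S a * b)"
    by (rule bilinear_mapI[OF module_axioms module_axioms module_axioms]) (simp_all add: S.add S.scale multilinear_simps)
  then have "sweedler scale (\<lambda>a b. S a * b) (\<Delta> 1) = S 1"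
    by (simp add: comult_one sweedler_one2[OF module_axioms])
  then show ?thesis using assms by (simp add: is_antipode_def counit_one)
qed

text \<open>
  Under convolution of bilinear maps \<open>K \<times> K \<rightarrow> K\<close>, the map \<open>(x, y) \<mapsto> S(x y)\<close> is a left inverse and
  \<open>(x, y) \<mapsto> S(y) S(x)\<close> a right inverse of the multiplication. They agree by associativity of
  convolution, which is coassociativity of \<open>\<Delta>\<close> in both arguments.
\<close>

lemma antipode_mult:
  assumes "is_antipode S"
  shows "S (x * y) = S y * S x"
proof -
  interpret S: module_hom scale scale S using assms by (simp add: is_antipode_def)
  let ?sw = "sweedler scale" and ?sw3 = "sweedler3 scale"
  note linear = S.add S.scale multilinear_simps mult.assoc[of "_ :: 'a"]
  have S_left: "?sw (\<lambda>a b. S a * b) (\<Delta> z) = scale (\<epsilon> z) 1"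
    and S_right: "?sw (\<lambda>a b. a * S b) (\<Delta> z) = scale (\<epsilon> z) 1" for z
    using assms by (simp_all add: is_antipode_def)
  have bil: "bilinear_map scale scale scale (\<lambda>a b. S a * b)"
    by (rule bilinear_mapI[OF module_axioms module_axioms module_axioms]) (simp_all add: linear)
  \<comment> \<open>The summand of the triple convolution product of \<open>S(x y)\<close>, \<open>x y\<close> and \<open>S(y) S(x)\<close>.\<close>
  define H where "H a b c a' b' c' = S (a * a') * (b * (b' * (S c' * S c)))" for a b c a' b' c'
  have H_inner: "trilinear_map scale scale (H a b c)" for a b c
    by (rule trilinear_mapI[OF module_axioms module_axioms]) (simp_all add: H_def linear)
  have H_outer: "trilinear_map scale scale (\<lambda>a b c. ?sw3 (H a b c) T)" for T
    by (rule trilinear_map_sweedler3[OF module_axioms], rule trilinear_mapI[OF module_axioms module_axioms])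
      (simp_all add: H_def linear)
  have left_unit: "S y * S x =
      ?sw (\<lambda>p q. ?sw (\<lambda>p' q'. scale (\<epsilon> (p * p')) (S q' * S q)) (\<Delta> y)) (\<Delta> x)"
  proof -
    have expand: "S z = ?sw (\<lambda>p q. scale (\<epsilon> p) (S q)) (\<Delta> z)" for z
      using sweedler_hom[OF S.module_hom_axioms, of "\<lambda>p q. scale (\<epsilon> p) q" "\<Delta> z"]
      by (simp add: counit_left S.scale)
    have "S y * S x =
        ?sw (\<lambda>p q. scale (\<epsilon> p) (S q)) (\<Delta> y) * ?sw (\<lambda>p q. scale (\<epsilon> p) (S q)) (\<Delta> x)"
      by (rule arg_cong2[where f = "(*)"]) (rule expand)+
    then show ?thesis
      by (simp add: sweedler_mult_const counit_mult linear
          flip: sweedler_scale_fun[OF module_axioms])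
  qed
  have cancel_left: "scale (\<epsilon> (p * p')) z =
      ?sw (\<lambda>a b. ?sw (\<lambda>a' b'. S (a * a') * (b * (b' * z))) (\<Delta> p')) (\<Delta> p)" for p p' z
  proof -
    have "scale (\<epsilon> (p * p')) z = ?sw (\<lambda>a b. S a * b) (mult2 (\<Delta> p) (\<Delta> p')) * z"
      by (simp add: S_left scale_mult_left flip: comult_mult)
    then show ?thesis
      by (simp add: sweedler_mult2[OF module_axioms bil] sweedler_mult_const mult.assoc)
  qed
  have "S y * S x = ?sw (\<lambda>p q. ?sw (\<lambda>p' q'. ?sw (\<lambda>a b. ?sw (\<lambda>a' b'.
      H a b q a' b' q') (\<Delta> p')) (\<Delta> p)) (\<Delta> y)) (\<Delta> x)"
    unfolding left_unit cancel_left H_def ..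
  also have "\<dots> = ?sw3 (\<lambda>a b c. ?sw3 (H a b c) (map_left \<Delta> (\<Delta> y))) (map_left \<Delta> (\<Delta> x))"
    unfolding sweedler3_map_left[OF module_axioms H_outer]
    unfolding sweedler3_map_left[OF module_axioms H_inner]
    by (subst sweedler_swap[OF module_axioms, where S = "\<Delta> y"]) (rule refl)
  also have "\<dots> = ?sw3 (\<lambda>a b c. ?sw3 (H a b c) (map_right \<Delta> (\<Delta> y))) (map_right \<Delta> (\<Delta> x))"
    by (simp only: coassoc)
  also have "\<dots> = ?sw (\<lambda>p q. ?sw (\<lambda>b c. ?sw (\<lambda>p' q'. ?sw (\<lambda>b' c'. H p b c p' b' c')
      (\<Delta> q')) (\<Delta> y)) (\<Delta> q)) (\<Delta> x)"
    unfolding sweedler3_map_right[OF module_axioms H_outer]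
    unfolding sweedler3_map_right[OF module_axioms H_inner] ..
  also have "\<dots> = ?sw (\<lambda>p q. ?sw (\<lambda>b c. ?sw (\<lambda>p' q'. scale (\<epsilon> q') (S (p * p') * (b * S c)))
      (\<Delta> y)) (\<Delta> q)) (\<Delta> x)"
  proof -
    have "?sw (\<lambda>b' c'. H p b c p' b' c') (\<Delta> q') =
        S (p * p') * (b * (?sw (\<lambda>b' c'. b' * S c') (\<Delta> q') * S c))" for p b c p' q'
      by (simp add: H_def sweedler_mult_const mult.assoc)
    then show ?thesis by (simp add: S_right linear)
  qed
  also have "\<dots> = ?sw (\<lambda>p q. ?sw (\<lambda>b c. S (p * y) * (b * S c)) (\<Delta> q)) (\<Delta> x)"
  proof -
    have hom: "module_hom scale scale (\<lambda>z. S (p * z) * w)" for p w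
      by (rule module_homI[OF module_axioms module_axioms]) (simp_all add: linear)
    have "?sw (\<lambda>p' q'. scale (\<epsilon> q') (S (p * p') * w)) (\<Delta> y) = S (p * y) * w" for p w
      using sweedler_hom[OF hom[of p w], of "\<lambda>a b. scale (\<epsilon> b) a" "\<Delta> y"]
      by (simp add: counit_right linear)
    then show ?thesis by simp
  qed
  also have "\<dots> = ?sw (\<lambda>p q. scale (\<epsilon> q) (S (p * y))) (\<Delta> x)"
    by (simp add: S_right scale_mult_right flip: sweedler_mult_const)
  also have "\<dots> = S (x * y)"
  proof -
    have hom: "module_hom scale scale (\<lambda>z. S (z * y))"
      by (rule module_homI[OF module_axioms module_axioms]) (simp_all add: linear)
    show ?thesis
      using sweedler_hom[OF hom, of "\<lambda>a b. scale (\<epsilon> b) a" "\<Delta> x"]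
      by (simp add: counit_right linear)
  qed
  finally show ?thesis by simp
qed

end


section \<open>The twisted Hopf algebra\<close>

lemma (in algebra_over) cube_inverse_unique:
  assumes "mult3 S X = one3" "mult3 X T = one3" "S \<in> tensor_cube" "T \<in> tensor_cube"
  shows "S = T"
proof -
  have "S = mult3 S (mult3 X T)" using assms by simp
  also have "\<dots> = T" by (rule mult3_cancel) fact+
  finally show ?thesis .
qed

lemma (in hopf_algebra) obtain_antipode: obtains S where "is_antipode S"
  using antipode unfolding is_antipode_def by blast

context hopf_twist
begin

abbreviation F_inv :: "('a \<times> 'a \<Rightarrow>\<^sub>0 'k) set"
  where "F_inv \<equiv> inverse2 F"

abbreviation comult_F :: "'a \<Rightarrow> ('a \<times> 'a \<Rightarrow>\<^sub>0 'k) set" (\<open>\<Delta>\<^sub>F\<close>)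
  where "\<Delta>\<^sub>F \<equiv> twisted_comult F \<Delta>"

lemmas F_in [simp] = inverse2(1,2)[OF F_invertible]
  and F_inverse [simp] = inverse2(3,4)[OF F_invertible]
  and F_cancel [simp] = inverse2(3,4)[OF F_invertible, THEN mult2_cancel]

lemma comult_F_linear: "linear2 \<Delta>\<^sub>F"
  using linear2_mult[OF comult_linear, of F F_inv] by (simp add: twisted_comult_def[abs_def])

lemma comult_F_mult: "\<Delta>\<^sub>F (x * y) = mult2 (\<Delta>\<^sub>F x) (\<Delta>\<^sub>F y)"
  by (simp add: twisted_comult_def comult_mult mult2_assoc)

lemma comult_F_one: "\<Delta>\<^sub>F 1 = one2"
  by (simp add: twisted_comult_def comult_one)

lemma leg_F_inverse [simp]:
  "mult3 (leg12 F) (leg12 F_inv) = one3" "mult3 (leg12 F_inv) (leg12 F) = one3"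
  "mult3 (leg13 F) (leg13 F_inv) = one3" "mult3 (leg13 F_inv) (leg13 F) = one3"
  "mult3 (leg23 F) (leg23 F_inv) = one3" "mult3 (leg23 F_inv) (leg23 F) = one3"
  by (simp_all add: leg_one flip: leg12_mult leg13_mult leg23_mult)

lemma map_comult_mult:
  "map_left \<Delta> (mult2 S T) = mult3 (map_left \<Delta> S) (map_left \<Delta> T)"
  "map_right \<Delta> (mult2 S T) = mult3 (map_right \<Delta> S) (map_right \<Delta> T)"
  by (rule map_left_mult map_right_mult; simp add: comult_linear comult_mult)+

lemma map_comult_one: "map_left \<Delta> one2 = one3" "map_right \<Delta> one2 = one3"
  by (simp_all add: map_left_one map_right_one comult_linear comult_one)

lemma map_F_inverse [simp]:
  "mult3 (map_left \<Delta> F) (map_left \<Delta> F_inv) = one3" "mult3 (map_left \<Delta> F_inv) (map_left \<Delta> F) = one3"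
  "mult3 (map_right \<Delta> F) (map_right \<Delta> F_inv) = one3" "mult3 (map_right \<Delta> F_inv) (map_right \<Delta> F) = one3"
  by (simp_all add: map_comult_one flip: map_comult_mult)

lemmas F_cancel3 [simp] = leg_F_inverse[THEN mult3_cancel] map_F_inverse[THEN mult3_cancel]

text \<open>
  The inverse of the cocycle condition: both sides are inverse to
  \<open>F\<^sub>1\<^sub>2 (\<Delta> \<otimes> id)(F) = F\<^sub>2\<^sub>3 (id \<otimes> \<Delta>)(F)\<close>.
\<close>

lemma inverse_cocycle:
  "mult3 (map_left \<Delta> F_inv) (leg12 F_inv) = mult3 (map_right \<Delta> F_inv) (leg23 F_inv)"
proof (rule cube_inverse_unique)
  show "mult3 (mult3 (map_left \<Delta> F_inv) (leg12 F_inv)) (mult3 (leg12 F) (map_left \<Delta> F)) = one3"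
    by (simp add: mult3_assoc)
  show "mult3 (mult3 (leg12 F) (map_left \<Delta> F)) (mult3 (map_right \<Delta> F_inv) (leg23 F_inv)) = one3"
    by (simp add: F_cocycle mult3_assoc)
qed simp_all

lemma map_left_comult_F:
  "map_left \<Delta>\<^sub>F T = mult3 (leg12 F) (mult3 (map_left \<Delta> T) (leg12 F_inv))"
proof -
  have "mult3 (map_left \<Delta>\<^sub>F T) (leg12 F) = mult3 (leg12 F) (map_left \<Delta> T)"
    by (rule map_left_intertwine) (simp add: twisted_comult_def mult2_assoc comult_in)
  then have "mult3 (mult3 (map_left \<Delta>\<^sub>F T) (leg12 F)) (leg12 F_inv) =
      mult3 (mult3 (leg12 F) (map_left \<Delta> T)) (leg12 F_inv)"
    by simp
  then show ?thesis by (simp add: mult3_assoc)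
qed

lemma map_right_comult_F:
  "map_right \<Delta>\<^sub>F T = mult3 (leg23 F) (mult3 (map_right \<Delta> T) (leg23 F_inv))"
proof -
  have "mult3 (map_right \<Delta>\<^sub>F T) (leg23 F) = mult3 (leg23 F) (map_right \<Delta> T)"
    by (rule map_right_intertwine[OF comult_linear comult_F_linear])
      (simp add: twisted_comult_def mult2_assoc comult_in)
  then have "mult3 (mult3 (map_right \<Delta>\<^sub>F T) (leg23 F)) (leg23 F_inv) =
      mult3 (mult3 (leg23 F) (map_right \<Delta> T)) (leg23 F_inv)"
    by simp
  then show ?thesis by (simp add: mult3_assoc)
qed

text \<open>
  The two sides are \<open>(\<Delta> \<otimes> id)(\<Delta> x)\<close> and \<open>(id \<otimes> \<Delta>)(\<Delta> x)\<close>, each multiplied on the left by one side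
  of the cocycle condition and on the right by its inverse.
\<close>

lemma comult_F_coassoc: "map_left \<Delta>\<^sub>F (\<Delta>\<^sub>F x) = map_right \<Delta>\<^sub>F (\<Delta>\<^sub>F x)"
proof -
  have "map_left \<Delta>\<^sub>F (\<Delta>\<^sub>F x) = mult3 (mult3 (leg12 F) (map_left \<Delta> F))
      (mult3 (map_left \<Delta> (\<Delta> x)) (mult3 (map_left \<Delta> F_inv) (leg12 F_inv)))"
    by (simp add: map_left_comult_F twisted_comult_def map_comult_mult mult3_assoc)
  also have "\<dots> = mult3 (mult3 (leg23 F) (map_right \<Delta> F))
      (mult3 (map_right \<Delta> (\<Delta> x)) (mult3 (map_right \<Delta> F_inv) (leg23 F_inv)))"
    by (simp only: F_cocycle inverse_cocycle coassoc)
  also have "\<dots> = map_right \<Delta>\<^sub>F (\<Delta>\<^sub>F x)"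
    by (simp add: map_right_comult_F twisted_comult_def map_comult_mult mult3_assoc)
  finally show ?thesis .
qed

lemma bilinear_counit:
  "bilinear_map scale scale scale (\<lambda>a b. scale (\<epsilon> a) b)"
  "bilinear_map scale scale scale (\<lambda>a b. scale (\<epsilon> b) a)"
  by (rule bilinear_mapI; simp add: module_axioms multilinear_simps)+

text \<open>
  \<open>\<epsilon> \<otimes> id\<close> and \<open>id \<otimes> \<epsilon>\<close> are algebra maps to \<open>K\<close>. They send \<open>F\<close> to \<open>1\<close>, hence also \<open>F\<inverse>\<close>, and
  therefore cannot distinguish the twisted coproduct from \<open>\<Delta>\<close>.
\<close>

lemma counit_left_mult:
  "sweedler scale (\<lambda>a b. scale (\<epsilon> a) b) (mult2 S T) =
    sweedler scale (\<lambda>a b. scale (\<epsilon> a) b) S * sweedler scale (\<lambda>a b. scale (\<epsilon> a) b) T"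
  by (simp add: sweedler_mult2[OF module_axioms bilinear_counit(1)] sweedler_mult_const
      counit_mult multilinear_simps)
    (simp add: sweedler_swap[OF module_axioms, of _ T] multilinear_simps
      flip: sweedler_scale_fun[OF module_axioms])

lemma counit_right_mult:
  "sweedler scale (\<lambda>a b. scale (\<epsilon> b) a) (mult2 S T) =
    sweedler scale (\<lambda>a b. scale (\<epsilon> b) a) S * sweedler scale (\<lambda>a b. scale (\<epsilon> b) a) T"
  by (simp add: sweedler_mult2[OF module_axioms bilinear_counit(2)] sweedler_mult_const
      counit_mult multilinear_simps)
    (simp add: sweedler_swap[OF module_axioms, of _ T] multilinear_simps
      flip: sweedler_scale_fun[OF module_axioms])

lemma F_inv_counit:
  "sweedler scale (\<lambda>a b. scale (\<epsilon> a) b) F_inv = 1"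
  "sweedler scale (\<lambda>a b. scale (\<epsilon> b) a) F_inv = 1"
  using counit_left_mult[of F F_inv] counit_right_mult[of F F_inv]
  by (simp_all add: F_counit_left F_counit_right counit_one
      sweedler_one2[OF module_axioms bilinear_counit(1)]
      sweedler_one2[OF module_axioms bilinear_counit(2)])

text \<open>
  In \<open>U S(a) V b\<close>, taken over \<open>F \<Delta>(x) F\<inverse>\<close>, the factor \<open>F\<close> cancels against \<open>V\<close>, then \<open>\<Delta>(x)\<close> contracts to \<open>\<epsilon>(x)\<close>, and \<open>F\<inverse>\<close> leaves
  another \<open>V\<close>, so that the result is \<open>\<epsilon>(x) U V\<close>; the other identity is symmetric. The cocycle condition
  enters through \<open>U V = 1\<close>.
\<close>

lemma antipode_comult_F:
  assumes S: "is_antipode S"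
  defines "U \<equiv> sweedler scale (\<lambda>a b. a * S b) F"
    and "V \<equiv> sweedler scale (\<lambda>a b. S a * b) F_inv"
  shows "sweedler scale (\<lambda>a b. U * S a * V * b) (\<Delta>\<^sub>F x) = scale (\<epsilon> x) 1"
    and "sweedler scale (\<lambda>a b. a * (U * S b * V)) (\<Delta>\<^sub>F x) = scale (\<epsilon> x) 1"
proof -
  interpret S: module_hom scale scale S using S by (simp add: is_antipode_def)
  let ?sw = "sweedler scale" and ?sw3 = "sweedler3 scale"
  note linear = S.add S.scale multilinear_simps mult.assoc[of "_ :: 'a"]
  note S_mult = antipode_mult[OF S] and S_one = antipode_one[OF S]
  have S_left: "?sw (\<lambda>a b. S a * b) (\<Delta> z) = scale (\<epsilon> z) 1"
    and S_right: "?sw (\<lambda>a b. a * S b) (\<Delta> z) = scale (\<epsilon> z) 1" for z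
    using S by (simp_all add: is_antipode_def)
  have bil_left: "bilinear_map scale scale scale (\<lambda>a b. S a * (w * b))" for w
    by (rule bilinear_mapI[OF module_axioms module_axioms module_axioms]) (simp_all add: linear)
  have bil_right: "bilinear_map scale scale scale (\<lambda>a b. a * (w * S b))" for w
    by (rule bilinear_mapI[OF module_axioms module_axioms module_axioms]) (simp_all add: linear)
  have left_mult: "?sw (\<lambda>a b. S a * (w * b)) (mult2 Y Z) =
      ?sw (\<lambda>a b. S a * (?sw (\<lambda>c d. S c * (w * d)) Y * b)) Z" for w Y Z
    by (simp add: sweedler_mult2[OF module_axioms bil_left] sweedler_mult_const S_mult mult.assoc)
      (simp add: sweedler_swap[OF module_axioms, of _ Z])
  have right_mult: "?sw (\<lambda>a b. a * (w * S b)) (mult2 Y Z) =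
      ?sw (\<lambda>a b. a * (?sw (\<lambda>c d. c * (w * S d)) Z * S b)) Y" for w Y Z
    by (simp add: sweedler_mult2[OF module_axioms bil_right] sweedler_mult_const S_mult mult.assoc)
  have left_F: "?sw (\<lambda>a b. S a * (V * b)) F = 1"
  proof -
    have "?sw (\<lambda>a b. S a * (1 * b)) (mult2 F_inv F) = 1"
      using sweedler_one2[OF module_axioms bil_left[of 1]] by (simp add: S_one)
    then show ?thesis unfolding left_mult by (simp add: V_def)
  qed
  have right_F_inv: "?sw (\<lambda>a b. a * (U * S b)) F_inv = 1"
  proof -
    have "?sw (\<lambda>a b. a * (1 * S b)) (mult2 F_inv F) = 1"
      using sweedler_one2[OF module_axioms bil_right[of 1]] by (simp add: S_one)
    then show ?thesis unfolding right_mult by (simp add: U_def)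
  qed
  \<comment> \<open>Applying \<open>a \<otimes> b \<otimes> c \<mapsto> a S(b) c\<close> to \<open>F\<^sub>2\<^sub>3\<inverse> F\<^sub>1\<^sub>2\<close> gives \<open>U V\<close>. By the cocycle condition that
    element is \<open>(id \<otimes> \<Delta>)(F) (\<Delta> \<otimes> id)(F\<inverse>)\<close>, where the antipode meets both coproducts and leaves
    only counits.\<close>
  have UV: "U * V = 1"
  proof -
    define h where "h a b c = a * (S b * c)" for a b c
    have h: "trilinear_map scale scale h"
      by (rule trilinear_mapI[OF module_axioms module_axioms]) (simp_all add: h_def linear)
    have h'': "trilinear_map scale scale (\<lambda>a' b' c'. h (a * a') (b * b') (c * c'))" for a b c
      by (rule trilinear_mapI[OF module_axioms module_axioms]) (simp_all add: h_def linear S_mult)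
    have h': "trilinear_map scale scale (\<lambda>a b c. ?sw3 (\<lambda>a' b' c'. h (a * a') (b * b') (c * c')) T)" for T
      by (rule trilinear_map_sweedler3[OF module_axioms], rule trilinear_mapI[OF module_axioms module_axioms])
        (simp_all add: h_def linear S_mult)
    have "U * V = ?sw3 h (mult3 (leg23 F_inv) (leg12 F))"
      unfolding sweedler3_mult3[OF module_axioms h] sweedler3_leg23[OF module_axioms h']
      unfolding sweedler3_leg12[OF module_axioms h'']
      by (simp add: U_def V_def sweedler_mult_const h_def S_mult mult.assoc)
    also have "mult3 (leg23 F_inv) (leg12 F) = mult3 (map_right \<Delta> F) (map_left \<Delta> F_inv)"
    proof -
      have "mult3 (leg23 F_inv) (leg12 F) =
          mult3 (leg23 F_inv) (mult3 (mult3 (leg12 F) (map_left \<Delta> F)) (map_left \<Delta> F_inv))"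
        by (simp add: mult3_assoc)
      then show ?thesis by (simp add: F_cocycle mult3_assoc)
    qed
    also have "?sw3 h \<dots> = ?sw (\<lambda>a b. ?sw (\<lambda>c d. ?sw (\<lambda>p q. ?sw (\<lambda>p' q'.
        a * (p' * (S q' * (S c * (d * q))))) (\<Delta> p)) F_inv) (\<Delta> b)) F"
      unfolding sweedler3_mult3[OF module_axioms h] sweedler3_map_right[OF module_axioms h']
      unfolding sweedler3_map_left[OF module_axioms h'']
      by (simp add: h_def S_mult mult.assoc)
    also have "\<dots> = ?sw (\<lambda>a b. ?sw (\<lambda>c d. ?sw (\<lambda>p q. scale (\<epsilon> p) (a * (S c * (d * q)))) F_inv) (\<Delta> b)) F"
    proof -
      have "?sw (\<lambda>p' q'. a * (p' * (S q' * w))) (\<Delta> p) = scale (\<epsilon> p) (a * w)" for a w p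
      proof -
        have "?sw (\<lambda>p' q'. a * (p' * (S q' * w))) (\<Delta> p) = a * (?sw (\<lambda>p' q'. p' * S q') (\<Delta> p) * w)"
          by (simp add: sweedler_mult_const mult.assoc)
        then show ?thesis by (simp add: S_right linear)
      qed
      then show ?thesis by simp
    qed
    also have "\<dots> = ?sw (\<lambda>a b. ?sw (\<lambda>c d. a * (S c * d)) (\<Delta> b)) F"
    proof -
      have "?sw (\<lambda>p q. scale (\<epsilon> p) (a * (w * (d * q)))) F_inv =
          a * (w * (d * ?sw (\<lambda>p q. scale (\<epsilon> p) q) F_inv))" for a w d
        by (simp add: sweedler_mult_const linear)
      then show ?thesis by (simp add: F_inv_counit)
    qed
    also have "\<dots> = 1"
      using F_counit_right by (simp add: S_left linear flip: sweedler_mult_const)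
    finally show ?thesis .
  qed
  have "?sw (\<lambda>a b. U * S a * V * b) (\<Delta>\<^sub>F x) = U * ?sw (\<lambda>a b. S a * (V * b)) (\<Delta>\<^sub>F x)"
    by (simp add: sweedler_mult_const mult.assoc)
  also have "\<dots> = U * ?sw (\<lambda>a b. S a * (1 * b)) (mult2 (\<Delta> x) F_inv)"
    unfolding twisted_comult_def mult2_assoc left_mult[of V F] left_F ..
  also have "\<dots> = U * ?sw (\<lambda>a b. S a * (scale (\<epsilon> x) 1 * b)) F_inv"
    unfolding left_mult by (simp add: S_left)
  also have "\<dots> = scale (\<epsilon> x) (U * V)"
    by (simp add: V_def linear sweedler_scale_fun[OF module_axioms])
  finally show "?sw (\<lambda>a b. U * S a * V * b) (\<Delta>\<^sub>F x) = scale (\<epsilon> x) 1"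
    by (simp add: UV)
  have "?sw (\<lambda>a b. a * (U * S b * V)) (\<Delta>\<^sub>F x) = ?sw (\<lambda>a b. a * (U * S b)) (\<Delta>\<^sub>F x) * V"
    by (simp add: sweedler_mult_const mult.assoc)
  also have "\<dots> = ?sw (\<lambda>a b. a * (1 * S b)) (mult2 F (\<Delta> x)) * V"
    unfolding twisted_comult_def right_mult[of U _ F_inv] right_F_inv ..
  also have "\<dots> = ?sw (\<lambda>a b. a * (scale (\<epsilon> x) 1 * S b)) F * V"
    unfolding right_mult by (simp add: S_right)
  also have "\<dots> = scale (\<epsilon> x) (U * V)"
    by (simp add: U_def linear sweedler_scale_fun[OF module_axioms])
  finally show "?sw (\<lambda>a b. a * (U * S b * V)) (\<Delta>\<^sub>F x) = scale (\<epsilon> x) 1"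
    by (simp add: UV)
qed

lemma hopf_algebra_twisted: "hopf_algebra scale \<Delta>\<^sub>F \<epsilon>"
proof unfold_locales
  obtain S where S: "is_antipode S" by (rule obtain_antipode)
  interpret S: module_hom scale scale S using S by (simp add: is_antipode_def)
  let ?U = "sweedler scale (\<lambda>a b. a * S b) F" and ?V = "sweedler scale (\<lambda>a b. S a * b) F_inv"
  have "module_hom scale scale (\<lambda>x. ?U * S x * ?V)"
    by (rule module_homI[OF module_axioms module_axioms]) (simp_all add: S.add S.scale multilinear_simps)
  then show "\<exists>S. module_hom scale scale S \<and>
      (\<forall>x. sweedler scale (\<lambda>a b. S a * b) (\<Delta>\<^sub>F x) = scale (\<epsilon> x) 1 \<and>
           sweedler scale (\<lambda>a b. a * S b) (\<Delta>\<^sub>F x) = scale (\<epsilon> x) 1)"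
    using antipode_comult_F[OF S] by (intro exI[of _ "\<lambda>x. ?U * S x * ?V"]) simp
  show "sweedler scale (\<lambda>a b. scale (\<epsilon> a) b) (\<Delta>\<^sub>F x) = x"
    and "sweedler scale (\<lambda>a b. scale (\<epsilon> b) a) (\<Delta>\<^sub>F x) = x" for x
    by (simp_all add: twisted_comult_def counit_left_mult counit_right_mult F_counit_left
        F_counit_right F_inv_counit counit_left counit_right)
qed (use comult_F_linear in \<open>simp_all add: linear2_def comult_F_mult comult_F_one
      comult_F_coassoc counit_linear counit_mult counit_one multilinear_simps\<close>)

end


section \<open>The twisted triangular structure\<close>

context triangular_hopf_algebra
begin

lemmas R_in [simp] = inverse2(1)[OF R_invertible]

lemma R_inverse [simp]: "mult2 R (flip R) = one2" "mult2 (flip R) R = one2"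
  using inverse2[OF R_invertible] by (simp_all add: R_triangular)

lemma R_intertwines: "mult2 (flip (\<Delta> x)) R = mult2 R (\<Delta> x)"
  by (simp add: R_comult R_triangular mult2_assoc comult_in)

lemma R_map_left: "mult3 (swap12 (map_left \<Delta> T)) (leg12 R) = mult3 (leg12 R) (map_left \<Delta> T)"
  unfolding swap12_map_left by (rule map_left_intertwine) (rule R_intertwines)

lemma R_map_right: "mult3 (swap23 (map_right \<Delta> T)) (leg23 R) = mult3 (leg23 R) (map_right \<Delta> T)"
  unfolding swap23_map_right[OF comult_linear]
  by (rule map_right_intertwine[OF comult_linear linear2_flip[OF comult_linear]])
    (rule R_intertwines)

end

text \<open>
  Since \<open>R\<inverse> = R\<^sub>2\<^sub>1\<close>, inverting the identity for \<open>\<Delta> \<otimes> id\<close> gives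
  \<open>(\<Delta> \<otimes> id)(R\<^sub>2\<^sub>1) = R\<^sub>3\<^sub>2 R\<^sub>3\<^sub>1\<close>, and rotating the three factors turns this into the identity for
  \<open>id \<otimes> \<Delta>\<close>.
\<close>

lemma (in hopf_algebra) hexagon_right_from_left:
  assumes R: "R \<in> tensor_square" "mult2 R (flip R) = one2" "mult2 (flip R) R = one2"
    and left: "map_left \<Delta> R = mult3 (leg13 R) (leg23 R)"
  shows "map_right \<Delta> R = mult3 (leg13 R) (leg12 R)"
proof -
  have leg_inverse: "mult3 (leg13 R) (leg13 (flip R)) = one3" "mult3 (leg23 R) (leg23 (flip R)) = one3"
    using R(2) by (simp_all add: leg_one flip: leg13_mult leg23_mult)
  have "map_left \<Delta> (flip R) = mult3 (leg23 (flip R)) (leg13 (flip R))"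
  proof (rule cube_inverse_unique)
    show "mult3 (map_left \<Delta> (flip R)) (map_left \<Delta> R) = one3"
      using R(3) comult_linear comult_mult comult_one
      by (simp add: map_left_one flip: map_left_mult)
    show "mult3 (map_left \<Delta> R) (mult3 (leg23 (flip R)) (leg13 (flip R))) = one3"
      by (simp add: left mult3_assoc leg_inverse mult3_cancel)
  qed simp_all
  then show ?thesis
    by (simp add: map_right_map_left[OF comult_linear] swap12_mult swap23_mult swap_leg flip_flip R(1))
qed

locale twisted_triangular_hopf_algebra =
  triangular_hopf_algebra scale comult counit R + hopf_twist scale comult counit F
  for scale :: "'k::comm_ring_1 \<Rightarrow> 'a::ring_1 \<Rightarrow> 'a"
    and comult :: "'a \<Rightarrow> ('a \<times> 'a \<Rightarrow>\<^sub>0 'k) set" (\<open>\<Delta>\<close>)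
    and counit :: "'a \<Rightarrow> 'k" (\<open>\<epsilon>\<close>)
    and R F :: "('a \<times> 'a \<Rightarrow>\<^sub>0 'k) set"
begin

abbreviation R_F :: "('a \<times> 'a \<Rightarrow>\<^sub>0 'k) set"
  where "R_F \<equiv> twisted_R F R"

lemma R_cancel [simp]:
  "T \<in> tensor_square \<Longrightarrow> mult2 R (mult2 (flip R) T) = T"
  "T \<in> tensor_square \<Longrightarrow> mult2 (flip R) (mult2 R T) = T"
  by (simp_all add: mult2_cancel)

lemma flip_F_inverse [simp]:
  "mult2 (flip F) (flip F_inv) = one2" "mult2 (flip F_inv) (flip F) = one2"
  by (simp_all add: flip_one flip: flip_mult)

lemma flip_F_cancel [simp]:
  "T \<in> tensor_square \<Longrightarrow> mult2 (flip F) (mult2 (flip F_inv) T) = T"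
  "T \<in> tensor_square \<Longrightarrow> mult2 (flip F_inv) (mult2 (flip F) T) = T"
  by (simp_all add: mult2_cancel)

lemma R_F_eq: "R_F = mult2 (flip F) (mult2 R F_inv)"
  by (simp add: twisted_R_def mult2_assoc)

lemma flip_R_F: "flip R_F = mult2 F (mult2 (flip R) (flip F_inv))"
  by (simp add: R_F_eq flip_mult flip_flip)

lemma R_F_is_inverse: "is_inverse2 R_F (flip R_F)"
  unfolding is_inverse2_def R_F_eq by (simp add: flip_mult flip_flip mult2_assoc)

lemma inverse_R_F: "inverse2 R_F = flip R_F"
  by (rule inverse2_eqI[OF R_F_is_inverse])

lemma R_F_comult: "flip (\<Delta>\<^sub>F x) = mult2 (mult2 R_F (\<Delta>\<^sub>F x)) (inverse2 R_F)"
  unfolding inverse_R_F unfolding flip_R_F unfolding R_F_eq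
  by (simp add: twisted_comult_def flip_mult mult2_assoc R_comult R_triangular)

text \<open>
  Both sides are words in permuted copies of \<open>F\<close>, \<open>R\<close> and \<open>G = F\<inverse>\<close>. Starting from
  \<open>F\<^sub>1\<^sub>2 (\<Delta> \<otimes> id)(F\<^sub>2\<^sub>1 R G) G\<^sub>1\<^sub>2\<close>, the cocycle condition, rotated so that it applies to
  \<open>F\<^sub>1\<^sub>2 (\<Delta> \<otimes> id)(F\<^sub>2\<^sub>1)\<close>, produces \<open>F\<^sub>3\<^sub>1\<close> and a permuted \<open>(\<Delta> \<otimes> id)(F)\<close>. Moving \<open>R\<^sub>1\<^sub>3\<close> past the latter flips
  its coproduct; the cocycle condition with the last two factors exchanged then produces
  \<open>G\<^sub>1\<^sub>3 F\<^sub>3\<^sub>2\<close> and a permuted \<open>(id \<otimes> \<Delta>)(F)\<close>, past which \<open>R\<^sub>2\<^sub>3\<close> moves, and the inverse cocycle condition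
  reduces the rest to \<open>G\<^sub>2\<^sub>3\<close>.
\<close>

lemma R_F_comult_left: "map_left \<Delta>\<^sub>F R_F = mult3 (leg13 R_F) (leg23 R_F)"
proof -
  let ?comult_left = "map_left \<Delta>" and ?comult_right = "map_right \<Delta>"
  have cocycle_cycled: "mult3 (leg12 F) (?comult_left (flip F)) =
      mult3 (leg13 (flip F)) (swap23 (swap12 (?comult_left F)))"
  proof -
    have "swap23 (swap12 (mult3 (leg12 F) (?comult_left F))) = swap23 (swap12 (mult3 (leg23 F) (?comult_right F)))"
      by (simp add: F_cocycle)
    moreover have "?comult_left (flip F) = swap23 (swap12 (?comult_right F))"
      by (simp add: map_left_map_right[OF comult_linear] flip_flip)
    ultimately show ?thesis
      by (simp add: swap12_mult swap23_mult swap_leg)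
  qed
  have R13_commutes: "mult3 (swap23 (swap12 (?comult_left F))) (leg13 R) = mult3 (leg13 R) (swap23 (?comult_left F))"
    using arg_cong[OF R_map_left[of F], of swap23] by (simp add: swap23_mult swap_leg)
  have cocycle_swapped: "swap23 (?comult_left F) =
      mult3 (leg13 F_inv) (mult3 (leg23 (flip F)) (swap23 (?comult_right F)))"
  proof -
    have "mult3 (leg13 F) (swap23 (?comult_left F)) = mult3 (leg23 (flip F)) (swap23 (?comult_right F))"
      using arg_cong[OF F_cocycle, of swap23] by (simp add: swap23_mult swap_leg)
    then have "mult3 (leg13 F_inv) (mult3 (leg13 F) (swap23 (?comult_left F))) =
        mult3 (leg13 F_inv) (mult3 (leg23 (flip F)) (swap23 (?comult_right F)))"
      by simp
    then show ?thesis by simp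
  qed
  have cocycle_end: "mult3 (?comult_right F) (mult3 (?comult_left F_inv) (leg12 F_inv)) = leg23 F_inv"
    by (simp add: inverse_cocycle)
  have "map_left \<Delta>\<^sub>F R_F = mult3 (mult3 (leg12 F) (?comult_left (flip F)))
      (mult3 (mult3 (leg13 R) (leg23 R)) (mult3 (?comult_left F_inv) (leg12 F_inv)))"
    by (simp add: map_left_comult_F R_F_eq map_comult_mult R_comult_left mult3_assoc)
  also have "\<dots> = mult3 (leg13 (flip F)) (mult3 (mult3 (swap23 (swap12 (?comult_left F))) (leg13 R))
      (mult3 (leg23 R) (mult3 (?comult_left F_inv) (leg12 F_inv))))"
    by (simp only: cocycle_cycled mult3_assoc)
  also have "\<dots> = mult3 (leg13 (flip F)) (mult3 (leg13 R) (mult3 (leg13 F_inv) (mult3 (leg23 (flip F))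
      (mult3 (mult3 (swap23 (?comult_right F)) (leg23 R)) (mult3 (?comult_left F_inv) (leg12 F_inv))))))"
    by (simp only: R13_commutes cocycle_swapped mult3_assoc)
  also have "\<dots> = mult3 (leg13 R_F) (leg23 R_F)"
    unfolding R_map_right
    by (simp add: R_F_eq leg13_mult leg23_mult mult3_assoc cocycle_end)
  finally show ?thesis .
qed

lemma triangular_hopf_algebra_twisted: "triangular_hopf_algebra scale \<Delta>\<^sub>F \<epsilon> R_F"
proof -
  interpret twisted: hopf_algebra scale \<Delta>\<^sub>F \<epsilon> by (rule hopf_algebra_twisted)
  have R_F_in: "R_F \<in> tensor_square" by (simp add: R_F_eq)
  show ?thesis
  proof unfold_locales
    show "invertible2 R_F"
      using R_F_in R_F_is_inverse by (auto simp: invertible2_def)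
    show "map_right \<Delta>\<^sub>F R_F = mult3 (leg13 R_F) (leg12 R_F)"
      using R_F_in R_F_is_inverse R_F_comult_left
      by (intro twisted.hexagon_right_from_left) (simp_all add: is_inverse2_def)
  qed (fact R_F_comult R_F_comult_left inverse_R_F)+
qed

end


section \<open>Tensors acting on multilinear maps\<close>

context hopf_module
begin

definition act2 ::
    "('a \<times> 'a \<Rightarrow>\<^sub>0 'k) set \<Rightarrow> ('g \<Rightarrow> 'g \<Rightarrow> 'g) \<Rightarrow> 'g \<Rightarrow> 'g \<Rightarrow> 'g"
  where "act2 T \<beta> u v = sweedler scale_g (\<lambda>a b. \<beta> (a \<triangleright> u) (b \<triangleright> v)) T"

definition act3 ::
    "('a \<times> 'a \<times> 'a \<Rightarrow>\<^sub>0 'k) set \<Rightarrow> ('g \<Rightarrow> 'g \<Rightarrow> 'g \<Rightarrow> 'g) \<Rightarrow> 'g \<Rightarrow> 'g \<Rightarrow> 'g \<Rightarrow> 'g"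
  where "act3 T \<tau> u v w = sweedler3 scale_g (\<lambda>a b c. \<tau> (a \<triangleright> u) (b \<triangleright> v) (c \<triangleright> w)) T"

abbreviation bilinear_g :: "('g \<Rightarrow> 'g \<Rightarrow> 'g) \<Rightarrow> bool"
  where "bilinear_g \<equiv> bilinear_map scale_g scale_g scale_g"

abbreviation trilinear_g :: "('g \<Rightarrow> 'g \<Rightarrow> 'g \<Rightarrow> 'g) \<Rightarrow> bool"
  where "trilinear_g \<equiv> trilinear_map scale_g scale_g"

lemmas act_linear = bilinear_mapD[OF act_bilinear]

lemma bilinear_act:
  assumes "bilinear_g \<beta>"
  shows "bilinear_map scale scale scale_g (\<lambda>a b. \<beta> (a \<triangleright> u) (b \<triangleright> v))"
  by (rule bilinear_mapI[OF module_axioms module_axioms g.module_axioms])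
    (simp_all add: act_linear bilinear_mapD[OF assms])

lemma trilinear_act:
  assumes "trilinear_g \<tau>"
  shows "trilinear_map scale scale_g (\<lambda>a b c. \<tau> (a \<triangleright> u) (b \<triangleright> v) (c \<triangleright> w))"
  by (rule trilinear_mapI[OF module_axioms g.module_axioms])
    (simp_all add: act_linear trilinear_mapD[OF assms])

lemma bilinear_act2:
  assumes "bilinear_g \<beta>"
  shows "bilinear_g (act2 T \<beta>)"
  by (rule bilinear_mapI[OF g.module_axioms g.module_axioms g.module_axioms])
    (simp_all add: act2_def act_linear bilinear_mapD[OF assms] sweedler_add_fun[OF g.module_axioms]
      sweedler_scale_fun[OF g.module_axioms])

lemma trilinear_act3:
  assumes "trilinear_g \<tau>"
  shows "trilinear_g (act3 T \<tau>)"
  by (rule trilinear_mapI[OF g.module_axioms g.module_axioms])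
    (simp_all add: act3_def act_linear trilinear_mapD[OF assms]
      sweedler3_add_fun[OF g.module_axioms] sweedler3_scale_fun[OF g.module_axioms])

lemma bilinear_opposite: "bilinear_g \<beta> \<Longrightarrow> bilinear_g (\<lambda>u v. \<beta> v u)"
  by (simp add: bilinear_map_def)

lemma trilinear_nested:
  assumes "bilinear_g \<beta>"
  shows "trilinear_g (\<lambda>u v w. \<beta> u (\<beta> v w))" "trilinear_g (\<lambda>u v w. \<beta> (\<beta> u v) w)"
    "trilinear_g (\<lambda>u v w. \<beta> v (\<beta> u w))"
  by (rule trilinear_mapI[OF g.module_axioms g.module_axioms];
      simp add: bilinear_mapD[OF assms])+

text \<open>
  The order of the factors is reversed: the outer tensor acts on the arguments first.
\<close>

lemma act2_act2:
  assumes "bilinear_g \<beta>"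
  shows "act2 T (act2 S \<beta>) = act2 (mult2 S T) \<beta>"
  by (intro ext, simp add: act2_def sweedler_mult2[OF g.module_axioms bilinear_act[OF assms]] act_mult)
    (rule sweedler_swap[OF g.module_axioms])

lemma act3_act3:
  assumes "trilinear_g \<tau>"
  shows "act3 T (act3 S \<tau>) = act3 (mult3 S T) \<tau>"
  by (intro ext, simp add: act3_def sweedler3_mult3[OF g.module_axioms trilinear_act[OF assms]] act_mult)
    (simp add: sweedler3_def case_prod_unfold linear_extension_swap[OF g.module_axioms,
        of _ "representative S"])

lemma act2_uminus: "act2 T (\<lambda>u v. - \<beta> u v) u v = - act2 T \<beta> u v"
  by (simp add: act2_def sweedler_uminus_fun[OF g.module_axioms])

lemma act3_add: "act3 T (\<lambda>u v w. \<tau> u v w + \<sigma> u v w) u v w = act3 T \<tau> u v w + act3 T \<sigma> u v w"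
  by (simp add: act3_def sweedler3_add_fun[OF g.module_axioms])

lemma act2_flip:
  assumes "bilinear_g \<beta>"
  shows "act2 (flip T) (\<lambda>u v. \<beta> v u) u v = act2 T \<beta> v u"
  by (simp add: act2_def sweedler_flip[OF g.module_axioms bilinear_act[OF bilinear_opposite[OF assms]]])

lemma act3_swap12:
  assumes "trilinear_g (\<lambda>u v w. \<tau> v u w)"
  shows "act3 (swap12 T) (\<lambda>u v w. \<tau> v u w) u v w = act3 T \<tau> v u w"
  by (simp add: act3_def sweedler3_swap12[OF g.module_axioms trilinear_act[OF assms]])

lemma act3_leg12:
  assumes "trilinear_g \<tau>"
  shows "act3 (leg12 T) \<tau> u v w = sweedler scale_g (\<lambda>a b. \<tau> (a \<triangleright> u) (b \<triangleright> v) w) T"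
  by (simp add: act3_def sweedler3_leg12[OF g.module_axioms trilinear_act[OF assms]] act_one)

lemma act_act2:
  assumes "bilinear_g \<beta>" and equivariant: "\<And>x u v. x \<triangleright> \<beta> u v = act2 (\<Delta> x) \<beta> u v"
  shows "x \<triangleright> act2 T \<beta> u v = act2 (mult2 (\<Delta> x) T) \<beta> u v"
proof -
  have hom: "module_hom scale_g scale_g ((\<triangleright>) x)"
    using act_bilinear by (simp add: bilinear_map_def)
  have "x \<triangleright> act2 T \<beta> u v = act2 T (act2 (\<Delta> x) \<beta>) u v"
    unfolding act2_def[of T] sweedler_hom[OF hom] equivariant ..
  then show ?thesis by (simp add: act2_act2[OF assms(1)])
qed

text \<open>
  Equivariance moves the second component \<open>T\<^sub>\<alpha>\<close> inside the inner bracket through \<open>\<Delta>(T\<^sub>\<alpha>)\<close>, so that \<open>T\<close>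
  enters as \<open>(id \<otimes> \<Delta>)(T)\<close>, while \<open>S\<close> acts on the last two arguments only.
\<close>

lemma act2_nested_right:
  assumes \<beta>: "bilinear_g \<beta>" and equivariant: "\<And>x u v. x \<triangleright> \<beta> u v = act2 (\<Delta> x) \<beta> u v"
  shows "act2 T \<beta> u (act2 S \<beta> v w) =
    act3 (mult3 (map_right \<Delta> T) (leg23 S)) (\<lambda>u v w. \<beta> u (\<beta> v w)) u v w"
proof -
  let ?\<tau> = "\<lambda>u v w. \<beta> u (\<beta> v w)" and ?sw = "sweedler scale_g"
  note \<tau> = trilinear_nested(1)[OF \<beta>]
  have hom: "module_hom scale_g scale_g (\<beta> x)" for x
    using \<beta> by (simp add: bilinear_map_def)
  have hom': "module_hom scale_g scale_g ((\<triangleright>) x)" for x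
    using act_bilinear by (simp add: bilinear_map_def)
  have "act2 T \<beta> u (act2 S \<beta> v w) = ?sw (\<lambda>a b. ?sw (\<lambda>c d. ?sw (\<lambda>e f.
      \<beta> (a \<triangleright> u) (\<beta> (e \<triangleright> c \<triangleright> v) (f \<triangleright> d \<triangleright> w))) (\<Delta> b)) S) T"
    by (simp add: act2_def equivariant sweedler_hom[OF hom] sweedler_hom[OF hom'])
  also have "\<dots> = ?sw (\<lambda>c d. act3 (map_right \<Delta> T) ?\<tau> u (c \<triangleright> v) (d \<triangleright> w)) S"
    unfolding act3_def sweedler3_map_right[OF g.module_axioms trilinear_act[OF \<tau>]]
    by (rule sweedler_swap[OF g.module_axioms])
  also have "\<dots> = act3 (leg23 S) (act3 (map_right \<Delta> T) ?\<tau>) u v w"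
    unfolding act3_def[of "leg23 S"]
    by (subst sweedler3_leg23[OF g.module_axioms trilinear_act[OF trilinear_act3[OF \<tau>]]])
      (simp add: act_one)
  finally show ?thesis by (simp add: act3_act3[OF \<tau>])
qed

lemma act2_nested_left:
  assumes \<beta>: "bilinear_g \<beta>" and equivariant: "\<And>x u v. x \<triangleright> \<beta> u v = act2 (\<Delta> x) \<beta> u v"
  shows "act2 T \<beta> (act2 S \<beta> u v) w =
    act3 (mult3 (map_left \<Delta> T) (leg12 S)) (\<lambda>u v w. \<beta> (\<beta> u v) w) u v w"
proof -
  let ?\<tau> = "\<lambda>u v w. \<beta> (\<beta> u v) w" and ?sw = "sweedler scale_g"
  note \<tau> = trilinear_nested(2)[OF \<beta>]
  have hom: "module_hom scale_g scale_g (\<lambda>y. \<beta> y x)" for x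
    using \<beta> by (simp add: bilinear_map_def)
  have hom': "module_hom scale_g scale_g ((\<triangleright>) x)" for x
    using act_bilinear by (simp add: bilinear_map_def)
  have "act2 T \<beta> (act2 S \<beta> u v) w = ?sw (\<lambda>a b. ?sw (\<lambda>c d. ?sw (\<lambda>e f.
      \<beta> (\<beta> (e \<triangleright> c \<triangleright> u) (f \<triangleright> d \<triangleright> v)) (b \<triangleright> w)) (\<Delta> a)) S) T"
    by (simp add: act2_def equivariant sweedler_hom[OF hom] sweedler_hom[OF hom'])
  also have "\<dots> = ?sw (\<lambda>c d. act3 (map_left \<Delta> T) ?\<tau> (c \<triangleright> u) (d \<triangleright> v) w) S"
    unfolding act3_def sweedler3_map_left[OF g.module_axioms trilinear_act[OF \<tau>]]
    by (rule sweedler_swap[OF g.module_axioms])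
  also have "\<dots> = act3 (leg12 S) (act3 (map_left \<Delta> T) ?\<tau>) u v w"
    by (simp add: act3_leg12[OF trilinear_act3[OF \<tau>]])
  finally show ?thesis by (simp add: act3_act3[OF \<tau>])
qed

end


section \<open>The twisted bracket\<close>

locale twisted_braided_lie_algebra =
  braided_lie_algebra scale comult counit R scale_g act bracket +
  twisted_triangular_hopf_algebra scale comult counit R F
  for scale :: "'k::comm_ring_1 \<Rightarrow> 'a::ring_1 \<Rightarrow> 'a"
    and comult :: "'a \<Rightarrow> ('a \<times> 'a \<Rightarrow>\<^sub>0 'k) set" (\<open>\<Delta>\<close>)
    and counit :: "'a \<Rightarrow> 'k" (\<open>\<epsilon>\<close>)
    and R F :: "('a \<times> 'a \<Rightarrow>\<^sub>0 'k) set"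
    and scale_g :: "'k \<Rightarrow> 'g::ab_group_add \<Rightarrow> 'g"
    and act :: "'a \<Rightarrow> 'g \<Rightarrow> 'g" (infixr \<open>\<triangleright>\<close> 75)
    and bracket :: "'g \<Rightarrow> 'g \<Rightarrow> 'g"
begin

abbreviation bracket_F :: "'g \<Rightarrow> 'g \<Rightarrow> 'g"
  where "bracket_F \<equiv> twisted_bracket F scale_g act bracket"

abbreviation bracket_opposite :: "'g \<Rightarrow> 'g \<Rightarrow> 'g"
  where "bracket_opposite \<equiv> \<lambda>u v. bracket v u"

lemma bracket_F_act2: "bracket_F = act2 F_inv bracket"
  by (simp add: fun_eq_iff twisted_bracket_def act2_def)

lemma bracket_act2: "x \<triangleright> bracket u v = act2 (\<Delta> x) bracket u v"
  by (simp add: bracket_equivariant act2_def)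

lemma bracket_F_bilinear: "bilinear_g bracket_F"
  unfolding bracket_F_act2 by (rule bilinear_act2[OF bracket_bilinear])

lemma bracket_F_equivariant: "x \<triangleright> bracket_F u v = act2 (\<Delta>\<^sub>F x) bracket_F u v"
  unfolding bracket_F_act2 act_act2[OF bracket_bilinear bracket_act2]
    act2_act2[OF bracket_bilinear]
  by (simp add: twisted_comult_def mult2_assoc)

lemma bracket_F_antisymmetric:
  "bracket_F u v = - sweedler scale_g (\<lambda>a b. bracket_F (b \<triangleright> v) (a \<triangleright> u)) R_F"
proof -
  note opposite = bilinear_opposite[OF bracket_bilinear]
  have "bracket = (\<lambda>u v. - act2 R bracket_opposite u v)"
    by (intro ext) (simp add: act2_def flip: bracket_antisymmetric)
  then have "bracket_F u v = act2 F_inv (\<lambda>u v. - act2 R bracket_opposite u v) u v"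
    by (simp add: bracket_F_act2)
  also have "\<dots> = - act2 (mult2 R F_inv) bracket_opposite u v"
    by (simp add: act2_uminus act2_act2[OF opposite])
  also have "mult2 R F_inv = mult2 (flip F_inv) R_F"
    by (simp add: R_F_eq)
  also have "act2 \<dots> bracket_opposite = act2 R_F (act2 (flip F_inv) bracket_opposite)"
    by (rule act2_act2[OF opposite, symmetric])
  also have "act2 (flip F_inv) bracket_opposite = (\<lambda>u v. bracket_F v u)"
    by (intro ext) (simp add: bracket_F_act2 act2_flip[OF bracket_bilinear])
  finally show ?thesis by (simp add: act2_def)
qed

text \<open>
  Acting with \<open>\<Phi>\<close> on the Jacobi identity turns the two nested brackets into twisted ones; the
  braided term is handled by \<open>\<Phi>\<^sub>2\<^sub>1\<^sub>3 (R\<^sub>F)\<^sub>1\<^sub>2 = R\<^sub>1\<^sub>2 \<Phi>\<close>.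
\<close>

lemma bracket_F_jacobi:
  "bracket_F u (bracket_F v w) = bracket_F (bracket_F u v) w +
    sweedler scale_g (\<lambda>a b. bracket_F (b \<triangleright> v) (bracket_F (a \<triangleright> u) w)) R_F"
proof -
  let ?right = "\<lambda>u v w. bracket u (bracket v w)" and ?left = "\<lambda>u v w. bracket (bracket u v) w"
    and ?swapped = "\<lambda>u v w. bracket v (bracket u w)"
  define \<Phi> where "\<Phi> = mult3 (map_left \<Delta> F_inv) (leg12 F_inv)"
  note swapped = trilinear_nested(3)[OF bracket_bilinear]
  have right_F: "bracket_F u (bracket_F v w) = act3 \<Phi> ?right u v w" for u v w
    unfolding bracket_F_act2 act2_nested_right[OF bracket_bilinear bracket_act2]
    by (simp add: \<Phi>_def inverse_cocycle)
  have left_F: "bracket_F (bracket_F u v) w = act3 \<Phi> ?left u v w" for u v w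
    unfolding bracket_F_act2 act2_nested_left[OF bracket_bilinear bracket_act2]
    by (simp add: \<Phi>_def)
  \<comment> \<open>With \<open>G = F\<inverse>\<close>, \<open>G\<^sub>2\<^sub>1 R\<^sub>F = R G\<close> removes the twist, and \<open>R\<^sub>1\<^sub>2\<close> then moves past the flipped coproduct of \<open>G\<close>.\<close>
  have swap_\<Phi>: "mult3 (swap12 \<Phi>) (leg12 R_F) = mult3 (leg12 R) \<Phi>"
  proof -
    have "mult3 (swap12 \<Phi>) (leg12 R_F) = mult3 (swap12 (map_left \<Delta> F_inv))
        (leg12 (mult2 (flip F_inv) R_F))"
      by (simp add: \<Phi>_def swap12_mult swap_leg leg12_mult mult3_assoc)
    also have "mult2 (flip F_inv) R_F = mult2 R F_inv"
      by (simp add: R_F_eq)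
    also have "mult3 (swap12 (map_left \<Delta> F_inv)) (leg12 (mult2 R F_inv)) =
        mult3 (mult3 (swap12 (map_left \<Delta> F_inv)) (leg12 R)) (leg12 F_inv)"
      by (simp add: leg12_mult mult3_assoc)
    also have "\<dots> = mult3 (leg12 R) \<Phi>"
      unfolding R_map_left \<Phi>_def mult3_assoc ..
    finally show ?thesis .
  qed
  have "?right = (\<lambda>u v w. ?left u v w + act3 (leg12 R) ?swapped u v w)"
    by (intro ext) (simp add: act3_leg12[OF swapped] flip: bracket_jacobi)
  then have "bracket_F u (bracket_F v w) =
      act3 \<Phi> (\<lambda>u v w. ?left u v w + act3 (leg12 R) ?swapped u v w) u v w"
    by (simp add: right_F)
  also have "\<dots> = bracket_F (bracket_F u v) w + act3 \<Phi> (act3 (leg12 R) ?swapped) u v w"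
    by (simp add: act3_add left_F)
  also have "act3 \<Phi> (act3 (leg12 R) ?swapped) = act3 (leg12 R_F) (act3 (swap12 \<Phi>) ?swapped)"
    by (simp add: act3_act3[OF swapped] swap_\<Phi>)
  also have "act3 (swap12 \<Phi>) ?swapped = (\<lambda>u v w. bracket_F v (bracket_F u w))"
    by (intro ext) (simp only: act3_swap12[OF swapped] right_F)
  also have "act3 (leg12 R_F) \<dots> u v w =
      sweedler scale_g (\<lambda>a b. bracket_F (b \<triangleright> v) (bracket_F (a \<triangleright> u) w)) R_F"
    by (rule act3_leg12[OF trilinear_nested(3)[OF bracket_F_bilinear]])
  finally show ?thesis .
qed

lemma braided_lie_algebra_twisted:
  "braided_lie_algebra scale \<Delta>\<^sub>F \<epsilon> R_F scale_g act bracket_F"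
proof -
  interpret twisted: triangular_hopf_algebra scale \<Delta>\<^sub>F \<epsilon> R_F
    by (rule triangular_hopf_algebra_twisted)
  show ?thesis
    by unfold_locales
      (fact act_bilinear act_one act_mult bracket_F_bilinear bracket_F_antisymmetric bracket_F_jacobi
        bracket_F_equivariant[unfolded act2_def])+
qed

end

theorem proposition5p14:
  fixes scale :: "'k::comm_ring_1 \<Rightarrow> 'a::ring_1 \<Rightarrow> 'a"
    and comult :: "'a \<Rightarrow> ('a \<times> 'a \<Rightarrow>\<^sub>0 'k) set"
    and counit :: "'a \<Rightarrow> 'k"
    and R F :: "('a \<times> 'a \<Rightarrow>\<^sub>0 'k) set"
    and scale_g :: "'k \<Rightarrow> 'g::ab_group_add \<Rightarrow> 'g"
    and act :: "'a \<Rightarrow> 'g \<Rightarrow> 'g"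
    and bracket :: "'g \<Rightarrow> 'g \<Rightarrow> 'g"
  assumes "field_or_power_series_ring TYPE('k) TYPE('f::field)"
    and "braided_lie_algebra scale comult counit R scale_g act bracket"
    and "hopf_twist scale comult counit F"
  shows "braided_lie_algebra scale
    (algebra_over.twisted_comult scale F comult)
    counit
    (algebra_over.twisted_R scale F R)
    scale_g act
    (algebra_over.twisted_bracket scale F scale_g act bracket)"
proof -
  interpret braided_lie_algebra scale comult counit R scale_g act bracket by fact
  interpret hopf_twist scale comult counit F by fact
  interpret twisted_braided_lie_algebra scale comult counit R F scale_g act bracket ..
  show ?thesis by (rule braided_lie_algebra_twisted)
qed

end
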